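(* Let $\mathrm{imp}\colon\mathrm{W2G}\to\mathrm{C2G}$ be a 2-functor which sends each weak 2-group $C$ to a coherent 2-group $\mathrm{imp}(C)$ obtained from $C$ by equipping each object of $C$ with an adjoint equivalence, and which acts as the identity on morphisms and 2-morphisms. Let $\mathrm{F}\colon\mathrm{C2G}\to\mathrm{W2G}$ be the forgetful 2-functor. Then the 2-functors $\mathrm{imp}\colon\mathrm{W2G}\to\mathrm{C2G}$ and $\mathrm{F}\colon\mathrm{C2G}\to\mathrm{W2G}$ extend to define a biequivalence between the 2-categories $\mathrm{W2G}$ and $\mathrm{C2G}$.
   Context: A weak monoidal category is a category $M$ with a functor $\otimes\colon M\times M\to M$, an object $1\in M$, and natural isomorphisms $a_{x,y,z}\colon (x\otimes y)\otimes z\to x\otimes(y\otimes z)$, $\ell_x\colon 1\otimes x\to x$, $r_x\colon x\otimes 1\to x$ satisfying Mac Lane's pentagon and triangle identities (i.e. a monoidal category in the usual, not necessarily strict, sense). A weak inverse of an object $x$ is an object $y$ such that $x\otimes y\cong 1$ and $y\otimes x\cong 1$; if one exists, $x$ is weakly invertible. A weak 2-group is a weak monoidal category in which all objects are weakly invertible and all morphisms are invertible. An adjunction in a weak monoidal category is a quadruple $(x,\bar{x},i_x,e_x)$ where $i_x\colon 1\to x\otimes\bar{x}$ and $e_x\colon \bar{x}\otimes x\to 1$ are morphisms satisfying the zig-zag identities: (1) the composite $1\otimes x \xrightarrow{i_x\otimes 1} (x\otimes\bar{x})\otimes x \xrightarrow{a_{x,\bar{x},x}} x\otimes(\bar{x}\otimes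 x)\xrightarrow{1\otimes e_x} x\otimes 1$ equals $1\otimes x\xrightarrow{\ell_x} x\xrightarrow{r_x^{-1}} x\otimes 1$; (2) the composite $\bar{x}\otimes 1\xrightarrow{1\otimes i_x}\bar{x}\otimes(x\otimes\bar{x})\xrightarrow{a^{-1}_{\bar{x},x,\bar{x}}}(\bar{x}\otimes x)\otimes\bar{x}\xrightarrow{e_x\otimes 1}1\otimes\bar{x}$ equals $\bar{x}\otimes 1\xrightarrow{r_{\bar{x}}}\bar{x}\xrightarrow{\ell_{\bar{x}}^{-1}}1\otimes\bar{x}$. An adjoint equivalence is an adjunction with $i_x$ and $e_x$ invertible. A coherent 2-group is a weak monoidal category in which every morphism is invertible and every object $x$ is equipped with an adjoint equivalence $(x,\bar{x},i_x,e_x)$. A weak monoidal functor $F\colon C\to C'$ is a functor with a natural isomorphism $F_2\colon F(x)\otimes F(y)\to F(x\otimes y)$ and an isomorphism $F_0\colon 1'\to F(1)$ satisfying the usual compatibility with the associators and the left and right unit isomorphisms (i.e. a strong monoidal functor). A weak monoidal natural transformation $\theta\colon F\Rightarrow G$ is a natural transformation with $G_2\circ(\theta_x\otimes\theta_y)=\theta_{x\otimes y}\circ F_2$ and $\theta_1\circ F_0=G_0$. A homomorphism between weak 2-groups, and likewise between coherent 2-groups, is a weak monoidal functor between the underlying weak monoidal categories; a 2-homomorphism between homomorphisms is a weak monoidal natural transformation. $\mathrm{W2G}$ (respectively $\mathrm{C2G}$) is the 2-category of weak (respectively coherent) 2-groups, homomorphisms between these, and 2-homomorphisms between those. The forgetful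 2-functor $\mathrm{F}\colon\mathrm{C2G}\to\mathrm{W2G}$ forgets the chosen adjoint equivalences on objects and acts as the identity on morphisms and 2-morphisms. Biequivalence is meant in the standard sense: 2-functors $P\colon A\to B$ and $Q\colon B\to A$ extend to a biequivalence when there are pseudonatural equivalences between $Q\circ P$ and the identity of $A$ and between $P\circ Q$ and the identity of $B$. *)

theory Defs
  imports Main "HOL-Library.FuncSet"
begin

section \<open>Categories and functors\<close>

text \<open>
  As in HOL-Algebra, a category is a record together with carrier sets; the values of the
  operations outside the carriers are irrelevant.
\<close>

record ('o, 'm) cat =
  Ob :: "'o set"
  Ar :: "'m set"
  Dom :: "'m \<Rightarrow> 'o"
  Cod :: "'m \<Rightarrow> 'o"
  Ident :: "'o \<Rightarrow> 'm"
  Comp :: "'m \<Rightarrow> 'm \<Rightarrow> 'm"  (infixr "\<cdot>\<index>" 55)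

definition hom :: "('o, 'm, 'z) cat_scheme \<Rightarrow> 'o \<Rightarrow> 'o \<Rightarrow> 'm set" where
  "hom C x y = {f \<in> Ar C. Dom C f = x \<and> Cod C f = y}"

locale category =
  fixes C :: "('o, 'm, 'z) cat_scheme" (structure)
  assumes Dom_Ob: "f \<in> Ar C \<Longrightarrow> Dom C f \<in> Ob C"
    and Cod_Ob: "f \<in> Ar C \<Longrightarrow> Cod C f \<in> Ob C"
    and Ident_hom: "x \<in> Ob C \<Longrightarrow> Ident C x \<in> hom C x x"
    and Comp_hom: "f \<in> hom C x y \<Longrightarrow> g \<in> hom C y z \<Longrightarrow> g \<cdot> f \<in> hom C x z"
    and Ident_left: "f \<in> hom C x y \<Longrightarrow> Ident C y \<cdot> f = f"
    and Ident_right: "f \<in> hom C x y \<Longrightarrow> f \<cdot> Ident C x = f"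
    and Comp_assoc: "f \<in> hom C w x \<Longrightarrow> g \<in> hom C x y \<Longrightarrow> h \<in> hom C y z
      \<Longrightarrow> (h \<cdot> g) \<cdot> f = h \<cdot> (g \<cdot> f)"

definition inverse_arrows :: "('o, 'm, 'z) cat_scheme \<Rightarrow> 'm \<Rightarrow> 'm \<Rightarrow> bool" where
  "inverse_arrows C f g \<longleftrightarrow>
     f \<in> Ar C \<and> g \<in> hom C (Cod C f) (Dom C f) \<and>
     g \<cdot>\<^bsub>C\<^esub> f = Ident C (Dom C f) \<and> f \<cdot>\<^bsub>C\<^esub> g = Ident C (Cod C f)"

definition iso_arr :: "('o, 'm, 'z) cat_scheme \<Rightarrow> 'm \<Rightarrow> bool" where
  "iso_arr C f \<longleftrightarrow> (\<exists>g. inverse_arrows C f g)"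

definition inv_arr :: "('o, 'm, 'z) cat_scheme \<Rightarrow> 'm \<Rightarrow> 'm" where
  "inv_arr C f = (THE g. inverse_arrows C f g)"

definition isomorphic :: "('o, 'm, 'z) cat_scheme \<Rightarrow> 'o \<Rightarrow> 'o \<Rightarrow> bool" where
  "isomorphic C x y \<longleftrightarrow> (\<exists>f \<in> hom C x y. iso_arr C f)"

definition prod_cat ::
  "('o, 'm, 'z) cat_scheme \<Rightarrow> ('p, 'n, 'y) cat_scheme \<Rightarrow> ('o \<times> 'p, 'm \<times> 'n) cat" where
  "prod_cat C D =
    \<lparr> Ob = Ob C \<times> Ob D,
      Ar = Ar C \<times> Ar D,
      Dom = (\<lambda>(f, g). (Dom C f, Dom D g)),
      Cod = (\<lambda>(f, g). (Cod C f, Cod D g)),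
      Ident = (\<lambda>(x, y). (Ident C x, Ident D y)),
      Comp = (\<lambda>(f', g') (f, g). (f' \<cdot>\<^bsub>C\<^esub> f, g' \<cdot>\<^bsub>D\<^esub> g)) \<rparr>"

locale cat_functor = C: category C + D: category D
  for C :: "('o, 'm, 'z) cat_scheme" and D :: "('p, 'n, 'y) cat_scheme" +
  fixes Fo :: "'o \<Rightarrow> 'p" and Fa :: "'m \<Rightarrow> 'n"
  assumes map_Ob: "x \<in> Ob C \<Longrightarrow> Fo x \<in> Ob D"
    and map_hom: "f \<in> hom C x y \<Longrightarrow> Fa f \<in> hom D (Fo x) (Fo y)"
    and map_Ident: "x \<in> Ob C \<Longrightarrow> Fa (Ident C x) = Ident D (Fo x)"
    and map_Comp: "f \<in> hom C x y \<Longrightarrow> g \<in> hom C y z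
      \<Longrightarrow> Fa (g \<cdot>\<^bsub>C\<^esub> f) = Fa g \<cdot>\<^bsub>D\<^esub> Fa f"

section \<open>Weak monoidal categories, functors and natural transformations\<close>

record ('o, 'm) moncat = "('o, 'm) cat" +
  TensOb :: "'o \<Rightarrow> 'o \<Rightarrow> 'o"  (infixr "\<odot>\<index>" 70)
  TensAr :: "'m \<Rightarrow> 'm \<Rightarrow> 'm"  (infixr "\<otimes>\<index>" 70)
  UnitOb :: 'o
  Assoc :: "'o \<Rightarrow> 'o \<Rightarrow> 'o \<Rightarrow> 'm"
  LUnit :: "'o \<Rightarrow> 'm"
  RUnit :: "'o \<Rightarrow> 'm"

locale weak_monoidal_category = category M
  for M :: "('o, 'm, 'z) moncat_scheme" (structure) +
  assumes tensor_functor: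
      "cat_functor (prod_cat M M) M (\<lambda>(x, y). x \<odot> y) (\<lambda>(f, g). f \<otimes> g)"
    and UnitOb_Ob: "UnitOb M \<in> Ob M"
    and Assoc_hom: "x \<in> Ob M \<Longrightarrow> y \<in> Ob M \<Longrightarrow> z \<in> Ob M
      \<Longrightarrow> Assoc M x y z \<in> hom M ((x \<odot> y) \<odot> z) (x \<odot> (y \<odot> z))"
    and Assoc_iso: "x \<in> Ob M \<Longrightarrow> y \<in> Ob M \<Longrightarrow> z \<in> Ob M \<Longrightarrow> iso_arr M (Assoc M x y z)"
    and Assoc_natural: "f \<in> hom M x x' \<Longrightarrow> g \<in> hom M y y' \<Longrightarrow> h \<in> hom M z z'
      \<Longrightarrow> Assoc M x' y' z' \<cdot> ((f \<otimes> g) \<otimes> h) = (f \<otimes> (g \<otimes> h)) \<cdot> Assoc M x y z"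
    and LUnit_hom: "x \<in> Ob M \<Longrightarrow> LUnit M x \<in> hom M (UnitOb M \<odot> x) x"
    and LUnit_iso: "x \<in> Ob M \<Longrightarrow> iso_arr M (LUnit M x)"
    and LUnit_natural: "f \<in> hom M x y
      \<Longrightarrow> LUnit M y \<cdot> (Ident M (UnitOb M) \<otimes> f) = f \<cdot> LUnit M x"
    and RUnit_hom: "x \<in> Ob M \<Longrightarrow> RUnit M x \<in> hom M (x \<odot> UnitOb M) x"
    and RUnit_iso: "x \<in> Ob M \<Longrightarrow> iso_arr M (RUnit M x)"
    and RUnit_natural: "f \<in> hom M x y
      \<Longrightarrow> RUnit M y \<cdot> (f \<otimes> Ident M (UnitOb M)) = f \<cdot> RUnit M x"
    and pentagon: "w \<in> Ob M \<Longrightarrow> x \<in> Ob M \<Longrightarrow> y \<in> Ob M \<Longrightarrow> z \<in> Ob M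
      \<Longrightarrow> (Ident M w \<otimes> Assoc M x y z) \<cdot> Assoc M w (x \<odot> y) z \<cdot> (Assoc M w x y \<otimes> Ident M z)
        = Assoc M w x (y \<odot> z) \<cdot> Assoc M (w \<odot> x) y z"
    and triangle: "x \<in> Ob M \<Longrightarrow> y \<in> Ob M
      \<Longrightarrow> (Ident M x \<otimes> LUnit M y) \<cdot> Assoc M x (UnitOb M) y = RUnit M x \<otimes> Ident M y"

record ('o, 'm, 'p, 'n) monfun =
  FunOb :: "'o \<Rightarrow> 'p"
  FunAr :: "'m \<Rightarrow> 'n"
  FunMult :: "'o \<Rightarrow> 'o \<Rightarrow> 'n"
  FunUnit :: 'n

text \<open>
  The components of a functor or a natural transformation are required to be \<^const>\<open>undefined\<close>
  outside the carriers, so that HOL equality of 1-cells and 2-cells is equality of the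
  functors and transformations they represent.
\<close>

locale weak_monoidal_functor =
  C: weak_monoidal_category C + D: weak_monoidal_category D +
  cat_functor C D "FunOb F" "FunAr F"
  for C :: "('o, 'm, 'z) moncat_scheme" and D :: "('p, 'n, 'y) moncat_scheme"
    and F :: "('o, 'm, 'p, 'n) monfun" +
  assumes FunOb_ext: "FunOb F \<in> extensional (Ob C)"
    and FunAr_ext: "FunAr F \<in> extensional (Ar C)"
    and FunMult_ext: "case_prod (FunMult F) \<in> extensional (Ob C \<times> Ob C)"
    and FunMult_hom: "x \<in> Ob C \<Longrightarrow> y \<in> Ob C
      \<Longrightarrow> FunMult F x y \<in> hom D (FunOb F x \<odot>\<^bsub>D\<^esub> FunOb F y) (FunOb F (x \<odot>\<^bsub>C\<^esub> y))"
    and FunMult_iso: "x \<in> Ob C \<Longrightarrow> y \<in> Ob C \<Longrightarrow> iso_arr D (FunMult F x y)"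
    and FunMult_natural: "f \<in> hom C x x' \<Longrightarrow> g \<in> hom C y y'
      \<Longrightarrow> FunMult F x' y' \<cdot>\<^bsub>D\<^esub> (FunAr F f \<otimes>\<^bsub>D\<^esub> FunAr F g)
        = FunAr F (f \<otimes>\<^bsub>C\<^esub> g) \<cdot>\<^bsub>D\<^esub> FunMult F x y"
    and FunUnit_hom: "FunUnit F \<in> hom D (UnitOb D) (FunOb F (UnitOb C))"
    and FunUnit_iso: "iso_arr D (FunUnit F)"
    and Assoc_compat: "x \<in> Ob C \<Longrightarrow> y \<in> Ob C \<Longrightarrow> z \<in> Ob C
      \<Longrightarrow> FunAr F (Assoc C x y z) \<cdot>\<^bsub>D\<^esub> FunMult F (x \<odot>\<^bsub>C\<^esub> y) z
            \<cdot>\<^bsub>D\<^esub> (FunMult F x y \<otimes>\<^bsub>D\<^esub> Ident D (FunOb F z))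
        = FunMult F x (y \<odot>\<^bsub>C\<^esub> z) \<cdot>\<^bsub>D\<^esub> (Ident D (FunOb F x) \<otimes>\<^bsub>D\<^esub> FunMult F y z)
            \<cdot>\<^bsub>D\<^esub> Assoc D (FunOb F x) (FunOb F y) (FunOb F z)"
    and LUnit_compat: "x \<in> Ob C
      \<Longrightarrow> FunAr F (LUnit C x) \<cdot>\<^bsub>D\<^esub> FunMult F (UnitOb C) x
            \<cdot>\<^bsub>D\<^esub> (FunUnit F \<otimes>\<^bsub>D\<^esub> Ident D (FunOb F x))
        = LUnit D (FunOb F x)"
    and RUnit_compat: "x \<in> Ob C
      \<Longrightarrow> FunAr F (RUnit C x) \<cdot>\<^bsub>D\<^esub> FunMult F x (UnitOb C)
            \<cdot>\<^bsub>D\<^esub> (Ident D (FunOb F x) \<otimes>\<^bsub>D\<^esub> FunUnit F)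
        = RUnit D (FunOb F x)"

record ('o, 'm, 'p, 'n) montrans =
  Src :: "('o, 'm, 'p, 'n) monfun"
  Tgt :: "('o, 'm, 'p, 'n) monfun"
  Cmpt :: "'o \<Rightarrow> 'n"

locale weak_monoidal_nat_trans =
  F: weak_monoidal_functor C D "Src \<theta>" + G: weak_monoidal_functor C D "Tgt \<theta>"
  for C :: "('o, 'm, 'z) moncat_scheme" and D :: "('p, 'n, 'y) moncat_scheme"
    and \<theta> :: "('o, 'm, 'p, 'n) montrans" +
  assumes Cmpt_ext: "Cmpt \<theta> \<in> extensional (Ob C)"
    and Cmpt_hom: "x \<in> Ob C
      \<Longrightarrow> Cmpt \<theta> x \<in> hom D (FunOb (Src \<theta>) x) (FunOb (Tgt \<theta>) x)"
    and Cmpt_natural: "f \<in> hom C x y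
      \<Longrightarrow> Cmpt \<theta> y \<cdot>\<^bsub>D\<^esub> FunAr (Src \<theta>) f = FunAr (Tgt \<theta>) f \<cdot>\<^bsub>D\<^esub> Cmpt \<theta> x"
    and Cmpt_tensor: "x \<in> Ob C \<Longrightarrow> y \<in> Ob C
      \<Longrightarrow> FunMult (Tgt \<theta>) x y \<cdot>\<^bsub>D\<^esub> (Cmpt \<theta> x \<otimes>\<^bsub>D\<^esub> Cmpt \<theta> y)
        = Cmpt \<theta> (x \<odot>\<^bsub>C\<^esub> y) \<cdot>\<^bsub>D\<^esub> FunMult (Src \<theta>) x y"
    and Cmpt_unit: "Cmpt \<theta> (UnitOb C) \<cdot>\<^bsub>D\<^esub> FunUnit (Src \<theta>) = FunUnit (Tgt \<theta>)"

definition id_monfun :: "('o, 'm, 'z) moncat_scheme \<Rightarrow> ('o, 'm, 'o, 'm) monfun" where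
  "id_monfun C =
    \<lparr> FunOb = (\<lambda>x\<in>Ob C. x),
      FunAr = (\<lambda>f\<in>Ar C. f),
      FunMult = curry (\<lambda>(x, y)\<in>Ob C \<times> Ob C. Ident C (x \<odot>\<^bsub>C\<^esub> y)),
      FunUnit = Ident C (UnitOb C) \<rparr>"

definition comp_monfun ::
  "('o, 'm, 'z) moncat_scheme \<Rightarrow> ('q, 'l, 'x) moncat_scheme
    \<Rightarrow> ('p, 'n, 'q, 'l) monfun \<Rightarrow> ('o, 'm, 'p, 'n) monfun \<Rightarrow> ('o, 'm, 'q, 'l) monfun" where
  "comp_monfun C E G F =
    \<lparr> FunOb = (\<lambda>x\<in>Ob C. FunOb G (FunOb F x)),
      FunAr = (\<lambda>f\<in>Ar C. FunAr G (FunAr F f)),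
      FunMult = curry (\<lambda>(x, y)\<in>Ob C \<times> Ob C.
        FunAr G (FunMult F x y) \<cdot>\<^bsub>E\<^esub> FunMult G (FunOb F x) (FunOb F y)),
      FunUnit = FunAr G (FunUnit F) \<cdot>\<^bsub>E\<^esub> FunUnit G \<rparr>"

definition hcomp_montrans ::
  "('o, 'm, 'z) moncat_scheme \<Rightarrow> ('q, 'l, 'x) moncat_scheme
    \<Rightarrow> ('p, 'n, 'q, 'l) montrans \<Rightarrow> ('o, 'm, 'p, 'n) montrans \<Rightarrow> ('o, 'm, 'q, 'l) montrans" where
  "hcomp_montrans C E \<eta> \<theta> =
    \<lparr> Src = comp_monfun C E (Src \<eta>) (Src \<theta>),
      Tgt = comp_monfun C E (Tgt \<eta>) (Tgt \<theta>),
      Cmpt = (\<lambda>x\<in>Ob C. Cmpt \<eta> (FunOb (Tgt \<theta>) x) \<cdot>\<^bsub>E\<^esub> FunAr (Src \<eta>) (Cmpt \<theta> x)) \<rparr>"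

definition monfun_cat ::
  "('o, 'm, 'z) moncat_scheme \<Rightarrow> ('p, 'n, 'y) moncat_scheme
    \<Rightarrow> (('o, 'm, 'p, 'n) monfun, ('o, 'm, 'p, 'n) montrans) cat" where
  "monfun_cat C D =
    \<lparr> Ob = {F. weak_monoidal_functor C D F},
      Ar = {\<theta>. weak_monoidal_nat_trans C D \<theta>},
      Dom = Src,
      Cod = Tgt,
      Ident = (\<lambda>F. \<lparr> Src = F, Tgt = F, Cmpt = (\<lambda>x\<in>Ob C. Ident D (FunOb F x)) \<rparr>),
      Comp = (\<lambda>\<eta> \<theta>. \<lparr> Src = Src \<theta>, Tgt = Tgt \<eta>,
                        Cmpt = (\<lambda>x\<in>Ob C. Cmpt \<eta> x \<cdot>\<^bsub>D\<^esub> Cmpt \<theta> x) \<rparr>) \<rparr>"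

section \<open>2-categories, 2-functors and biequivalences\<close>

text \<open>
  A (strict) 2-category is given by a category of 1-cells and 2-cells between any two objects,
  together with composition functors. Hom-categories of different pairs of objects need not be
  disjoint, so the operations take the objects involved as arguments: \<open>Comp1 A x y z g f\<close> and
  \<open>Comp2 A x y z \<beta> \<alpha>\<close> compose cells \<open>x \<rightarrow> y \<rightarrow> z\<close>.
\<close>

record ('a, 'f, 't) two_cat =
  Ob0 :: "'a set"
  Hom :: "'a \<Rightarrow> 'a \<Rightarrow> ('f, 't) cat"
  Unit1 :: "'a \<Rightarrow> 'f"
  Comp1 :: "'a \<Rightarrow> 'a \<Rightarrow> 'a \<Rightarrow> 'f \<Rightarrow> 'f \<Rightarrow> 'f"
  Comp2 :: "'a \<Rightarrow> 'a \<Rightarrow> 'a \<Rightarrow> 't \<Rightarrow> 't \<Rightarrow> 't"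

abbreviation Unit2 :: "('a, 'f, 't) two_cat \<Rightarrow> 'a \<Rightarrow> 't" where
  "Unit2 A x \<equiv> Ident (Hom A x x) (Unit1 A x)"

abbreviation whisker_left ::
  "('a, 'f, 't) two_cat \<Rightarrow> 'a \<Rightarrow> 'a \<Rightarrow> 'a \<Rightarrow> 'f \<Rightarrow> 't \<Rightarrow> 't" where
  "whisker_left A x y z g \<alpha> \<equiv> Comp2 A x y z (Ident (Hom A y z) g) \<alpha>"

abbreviation whisker_right ::
  "('a, 'f, 't) two_cat \<Rightarrow> 'a \<Rightarrow> 'a \<Rightarrow> 'a \<Rightarrow> 't \<Rightarrow> 'f \<Rightarrow> 't" where
  "whisker_right A x y z \<beta> f \<equiv> Comp2 A x y z \<beta> (Ident (Hom A x y) f)"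

locale two_category =
  fixes A :: "('a, 'f, 't) two_cat"
  assumes Hom_category: "x \<in> Ob0 A \<Longrightarrow> y \<in> Ob0 A \<Longrightarrow> category (Hom A x y)"
    and Unit1_Ob: "x \<in> Ob0 A \<Longrightarrow> Unit1 A x \<in> Ob (Hom A x x)"
    and Comp_functor: "x \<in> Ob0 A \<Longrightarrow> y \<in> Ob0 A \<Longrightarrow> z \<in> Ob0 A
      \<Longrightarrow> cat_functor (prod_cat (Hom A y z) (Hom A x y)) (Hom A x z)
            (\<lambda>(g, f). Comp1 A x y z g f) (\<lambda>(\<beta>, \<alpha>). Comp2 A x y z \<beta> \<alpha>)"
    and Comp1_unit_left: "x \<in> Ob0 A \<Longrightarrow> y \<in> Ob0 A \<Longrightarrow> f \<in> Ob (Hom A x y)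
      \<Longrightarrow> Comp1 A x y y (Unit1 A y) f = f"
    and Comp1_unit_right: "x \<in> Ob0 A \<Longrightarrow> y \<in> Ob0 A \<Longrightarrow> f \<in> Ob (Hom A x y)
      \<Longrightarrow> Comp1 A x x y f (Unit1 A x) = f"
    and Comp1_assoc: "w \<in> Ob0 A \<Longrightarrow> x \<in> Ob0 A \<Longrightarrow> y \<in> Ob0 A \<Longrightarrow> z \<in> Ob0 A
      \<Longrightarrow> f \<in> Ob (Hom A w x) \<Longrightarrow> g \<in> Ob (Hom A x y) \<Longrightarrow> h \<in> Ob (Hom A y z)
      \<Longrightarrow> Comp1 A w x z (Comp1 A x y z h g) f = Comp1 A w y z h (Comp1 A w x y g f)"
    and Comp2_unit_left: "x \<in> Ob0 A \<Longrightarrow> y \<in> Ob0 A \<Longrightarrow> \<alpha> \<in> Ar (Hom A x y)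
      \<Longrightarrow> Comp2 A x y y (Unit2 A y) \<alpha> = \<alpha>"
    and Comp2_unit_right: "x \<in> Ob0 A \<Longrightarrow> y \<in> Ob0 A \<Longrightarrow> \<alpha> \<in> Ar (Hom A x y)
      \<Longrightarrow> Comp2 A x x y \<alpha> (Unit2 A x) = \<alpha>"
    and Comp2_assoc: "w \<in> Ob0 A \<Longrightarrow> x \<in> Ob0 A \<Longrightarrow> y \<in> Ob0 A \<Longrightarrow> z \<in> Ob0 A
      \<Longrightarrow> \<alpha> \<in> Ar (Hom A w x) \<Longrightarrow> \<beta> \<in> Ar (Hom A x y) \<Longrightarrow> \<gamma> \<in> Ar (Hom A y z)
      \<Longrightarrow> Comp2 A w x z (Comp2 A x y z \<gamma> \<beta>) \<alpha> = Comp2 A w y z \<gamma> (Comp2 A w x y \<beta> \<alpha>)"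

record ('a, 'f, 't, 'b, 'g, 's) two_map =
  Map0 :: "'a \<Rightarrow> 'b"
  Map1 :: "'a \<Rightarrow> 'a \<Rightarrow> 'f \<Rightarrow> 'g"
  Map2 :: "'a \<Rightarrow> 'a \<Rightarrow> 't \<Rightarrow> 's"

text \<open>
  \<open>two_functor\<close>, \<open>pseudonatural_transformation\<close> and \<open>modification\<close> state typing and preservation
  laws only, in the way \<open>hom G H\<close> does for groups; that \<open>A\<close> and \<open>B\<close> are 2-categories is a
  separate predicate, included in \<open>biequivalence\<close>.
\<close>

locale two_functor =
  fixes A :: "('a, 'f, 't) two_cat" and B :: "('b, 'g, 's) two_cat"
    and P :: "('a, 'f, 't, 'b, 'g, 's) two_map"
  assumes Map0_Ob: "x \<in> Ob0 A \<Longrightarrow> Map0 P x \<in> Ob0 B"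
    and Map_functor: "x \<in> Ob0 A \<Longrightarrow> y \<in> Ob0 A
      \<Longrightarrow> cat_functor (Hom A x y) (Hom B (Map0 P x) (Map0 P y)) (Map1 P x y) (Map2 P x y)"
    and Map1_unit: "x \<in> Ob0 A \<Longrightarrow> Map1 P x x (Unit1 A x) = Unit1 B (Map0 P x)"
    and Map1_comp: "x \<in> Ob0 A \<Longrightarrow> y \<in> Ob0 A \<Longrightarrow> z \<in> Ob0 A
      \<Longrightarrow> f \<in> Ob (Hom A x y) \<Longrightarrow> g \<in> Ob (Hom A y z)
      \<Longrightarrow> Map1 P x z (Comp1 A x y z g f)
        = Comp1 B (Map0 P x) (Map0 P y) (Map0 P z) (Map1 P y z g) (Map1 P x y f)"
    and Map2_comp: "x \<in> Ob0 A \<Longrightarrow> y \<in> Ob0 A \<Longrightarrow> z \<in> Ob0 A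
      \<Longrightarrow> \<alpha> \<in> Ar (Hom A x y) \<Longrightarrow> \<beta> \<in> Ar (Hom A y z)
      \<Longrightarrow> Map2 P x z (Comp2 A x y z \<beta> \<alpha>)
        = Comp2 B (Map0 P x) (Map0 P y) (Map0 P z) (Map2 P y z \<beta>) (Map2 P x y \<alpha>)"

definition id_two_map :: "('a, 'f, 't, 'a, 'f, 't) two_map" where
  "id_two_map = \<lparr> Map0 = (\<lambda>x. x), Map1 = (\<lambda>x y f. f), Map2 = (\<lambda>x y \<alpha>. \<alpha>) \<rparr>"

definition comp_two_map ::
  "('b, 'g, 's, 'c, 'h, 'r) two_map \<Rightarrow> ('a, 'f, 't, 'b, 'g, 's) two_map
    \<Rightarrow> ('a, 'f, 't, 'c, 'h, 'r) two_map" where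
  "comp_two_map Q P =
    \<lparr> Map0 = (\<lambda>x. Map0 Q (Map0 P x)),
      Map1 = (\<lambda>x y f. Map1 Q (Map0 P x) (Map0 P y) (Map1 P x y f)),
      Map2 = (\<lambda>x y \<alpha>. Map2 Q (Map0 P x) (Map0 P y) (Map2 P x y \<alpha>)) \<rparr>"

text \<open>
  A pseudonatural transformation \<open>\<sigma>: P \<Rightarrow> Q\<close> has 1-cells \<open>\<sigma>\<^sub>x: P x \<rightarrow> Q x\<close> and invertible 2-cells
  \<open>\<sigma>\<^sub>f: Q f \<circ> \<sigma>\<^sub>x \<Rightarrow> \<sigma>\<^sub>y \<circ> P f\<close> for \<open>f: x \<rightarrow> y\<close>.
\<close>

record ('a, 'f, 'g, 's) ptrans =
  PT1 :: "'a \<Rightarrow> 'g"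
  PT2 :: "'a \<Rightarrow> 'a \<Rightarrow> 'f \<Rightarrow> 's"

locale pseudonatural_transformation = P: two_functor A B P + Q: two_functor A B Q
  for A :: "('a, 'f, 't) two_cat" and B :: "('b, 'g, 's) two_cat"
    and P Q :: "('a, 'f, 't, 'b, 'g, 's) two_map" +
  fixes \<sigma> :: "('a, 'f, 'g, 's) ptrans"
  assumes PT1_Ob: "x \<in> Ob0 A \<Longrightarrow> PT1 \<sigma> x \<in> Ob (Hom B (Map0 P x) (Map0 Q x))"
    and PT2_hom: "x \<in> Ob0 A \<Longrightarrow> y \<in> Ob0 A \<Longrightarrow> f \<in> Ob (Hom A x y)
      \<Longrightarrow> PT2 \<sigma> x y f \<in> hom (Hom B (Map0 P x) (Map0 Q y))
            (Comp1 B (Map0 P x) (Map0 Q x) (Map0 Q y) (Map1 Q x y f) (PT1 \<sigma> x))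
            (Comp1 B (Map0 P x) (Map0 P y) (Map0 Q y) (PT1 \<sigma> y) (Map1 P x y f))"
    and PT2_iso: "x \<in> Ob0 A \<Longrightarrow> y \<in> Ob0 A \<Longrightarrow> f \<in> Ob (Hom A x y)
      \<Longrightarrow> iso_arr (Hom B (Map0 P x) (Map0 Q y)) (PT2 \<sigma> x y f)"
    and PT2_natural: "x \<in> Ob0 A \<Longrightarrow> y \<in> Ob0 A \<Longrightarrow> \<alpha> \<in> hom (Hom A x y) f f'
      \<Longrightarrow> PT2 \<sigma> x y f' \<cdot>\<^bsub>Hom B (Map0 P x) (Map0 Q y)\<^esub>
            whisker_right B (Map0 P x) (Map0 Q x) (Map0 Q y) (Map2 Q x y \<alpha>) (PT1 \<sigma> x)
        = whisker_left B (Map0 P x) (Map0 P y) (Map0 Q y) (PT1 \<sigma> y) (Map2 P x y \<alpha>)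
            \<cdot>\<^bsub>Hom B (Map0 P x) (Map0 Q y)\<^esub> PT2 \<sigma> x y f"
    and PT2_unit: "x \<in> Ob0 A
      \<Longrightarrow> PT2 \<sigma> x x (Unit1 A x) = Ident (Hom B (Map0 P x) (Map0 Q x)) (PT1 \<sigma> x)"
    and PT2_comp: "x \<in> Ob0 A \<Longrightarrow> y \<in> Ob0 A \<Longrightarrow> z \<in> Ob0 A
      \<Longrightarrow> f \<in> Ob (Hom A x y) \<Longrightarrow> g \<in> Ob (Hom A y z)
      \<Longrightarrow> PT2 \<sigma> x z (Comp1 A x y z g f)
        = whisker_right B (Map0 P x) (Map0 P y) (Map0 Q z) (PT2 \<sigma> y z g) (Map1 P x y f)
            \<cdot>\<^bsub>Hom B (Map0 P x) (Map0 Q z)\<^esub>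
          whisker_left B (Map0 P x) (Map0 Q y) (Map0 Q z) (Map1 Q y z g) (PT2 \<sigma> x y f)"

definition id_ptrans ::
  "('b, 'g, 's) two_cat \<Rightarrow> ('a, 'f, 't, 'b, 'g, 's) two_map \<Rightarrow> ('a, 'f, 'g, 's) ptrans" where
  "id_ptrans B P =
    \<lparr> PT1 = (\<lambda>x. Unit1 B (Map0 P x)),
      PT2 = (\<lambda>x y f. Ident (Hom B (Map0 P x) (Map0 P y)) (Map1 P x y f)) \<rparr>"

text \<open>The composite of \<open>\<sigma>: P \<Rightarrow> Q\<close> and \<open>\<tau>: Q \<Rightarrow> R\<close>.\<close>

definition comp_ptrans ::
  "('b, 'g, 's) two_cat \<Rightarrow> ('a, 'f, 't, 'b, 'g, 's) two_map \<Rightarrow> ('a, 'f, 't, 'b, 'g, 's) two_map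
    \<Rightarrow> ('a, 'f, 't, 'b, 'g, 's) two_map \<Rightarrow> ('a, 'f, 'g, 's) ptrans \<Rightarrow> ('a, 'f, 'g, 's) ptrans
    \<Rightarrow> ('a, 'f, 'g, 's) ptrans" where
  "comp_ptrans B P Q R \<tau> \<sigma> =
    \<lparr> PT1 = (\<lambda>x. Comp1 B (Map0 P x) (Map0 Q x) (Map0 R x) (PT1 \<tau> x) (PT1 \<sigma> x)),
      PT2 = (\<lambda>x y f.
        whisker_left B (Map0 P x) (Map0 Q y) (Map0 R y) (PT1 \<tau> y) (PT2 \<sigma> x y f)
          \<cdot>\<^bsub>Hom B (Map0 P x) (Map0 R y)\<^esub>
        whisker_right B (Map0 P x) (Map0 Q x) (Map0 R y) (PT2 \<tau> x y f) (PT1 \<sigma> x)) \<rparr>"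

locale modification =
  \<sigma>: pseudonatural_transformation A B P Q \<sigma> + \<tau>: pseudonatural_transformation A B P Q \<tau>
  for A :: "('a, 'f, 't) two_cat" and B :: "('b, 'g, 's) two_cat"
    and P Q :: "('a, 'f, 't, 'b, 'g, 's) two_map" and \<sigma> \<tau> :: "('a, 'f, 'g, 's) ptrans" +
  fixes \<Gamma> :: "'a \<Rightarrow> 's"
  assumes mod_hom: "x \<in> Ob0 A
      \<Longrightarrow> \<Gamma> x \<in> hom (Hom B (Map0 P x) (Map0 Q x)) (PT1 \<sigma> x) (PT1 \<tau> x)"
    and mod_natural: "x \<in> Ob0 A \<Longrightarrow> y \<in> Ob0 A \<Longrightarrow> f \<in> Ob (Hom A x y)
      \<Longrightarrow> whisker_right B (Map0 P x) (Map0 P y) (Map0 Q y) (\<Gamma> y) (Map1 P x y f)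
            \<cdot>\<^bsub>Hom B (Map0 P x) (Map0 Q y)\<^esub> PT2 \<sigma> x y f
        = PT2 \<tau> x y f \<cdot>\<^bsub>Hom B (Map0 P x) (Map0 Q y)\<^esub>
          whisker_left B (Map0 P x) (Map0 Q x) (Map0 Q y) (Map1 Q x y f) (\<Gamma> x)"

definition invertible_modification ::
  "('a, 'f, 't) two_cat \<Rightarrow> ('b, 'g, 's) two_cat \<Rightarrow> ('a, 'f, 't, 'b, 'g, 's) two_map
    \<Rightarrow> ('a, 'f, 't, 'b, 'g, 's) two_map \<Rightarrow> ('a, 'f, 'g, 's) ptrans \<Rightarrow> ('a, 'f, 'g, 's) ptrans
    \<Rightarrow> ('a \<Rightarrow> 's) \<Rightarrow> bool" where
  "invertible_modification A B P Q \<sigma> \<tau> \<Gamma> \<longleftrightarrow>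
     modification A B P Q \<sigma> \<tau> \<Gamma> \<and>
     (\<forall>x\<in>Ob0 A. iso_arr (Hom B (Map0 P x) (Map0 Q x)) (\<Gamma> x))"

text \<open>
  A pseudonatural equivalence is an equivalence in the 2-category of 2-functors, pseudonatural
  transformations and modifications.
\<close>

definition pseudonatural_equivalence ::
  "('a, 'f, 't) two_cat \<Rightarrow> ('b, 'g, 's) two_cat \<Rightarrow> ('a, 'f, 't, 'b, 'g, 's) two_map
    \<Rightarrow> ('a, 'f, 't, 'b, 'g, 's) two_map \<Rightarrow> ('a, 'f, 'g, 's) ptrans \<Rightarrow> bool" where
  "pseudonatural_equivalence A B P Q \<sigma> \<longleftrightarrow>
     pseudonatural_transformation A B P Q \<sigma> \<and>
     (\<exists>\<tau>. pseudonatural_transformation A B Q P \<tau> \<and>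
       (\<exists>\<Gamma>. invertible_modification A B P P (comp_ptrans B P Q P \<tau> \<sigma>) (id_ptrans B P) \<Gamma>) \<and>
       (\<exists>\<Delta>. invertible_modification A B Q Q (comp_ptrans B Q P Q \<sigma> \<tau>) (id_ptrans B Q) \<Delta>))"

definition biequivalence ::
  "('a, 'f, 't) two_cat \<Rightarrow> ('b, 'g, 's) two_cat \<Rightarrow> ('a, 'f, 't, 'b, 'g, 's) two_map
    \<Rightarrow> ('b, 'g, 's, 'a, 'f, 't) two_map \<Rightarrow> bool" where
  "biequivalence A B P Q \<longleftrightarrow>
     two_category A \<and> two_category B \<and>
     two_functor A B P \<and> two_functor B A Q \<and>
     (\<exists>\<sigma>. pseudonatural_equivalence A A (comp_two_map Q P) id_two_map \<sigma>) \<and>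
     (\<exists>\<sigma>. pseudonatural_equivalence B B (comp_two_map P Q) id_two_map \<sigma>)"

section \<open>Weak and coherent 2-groups\<close>

definition weak_inverse :: "('o, 'm, 'z) moncat_scheme \<Rightarrow> 'o \<Rightarrow> 'o \<Rightarrow> bool" where
  "weak_inverse M x y \<longleftrightarrow>
     y \<in> Ob M \<and> isomorphic M (x \<odot>\<^bsub>M\<^esub> y) (UnitOb M) \<and> isomorphic M (y \<odot>\<^bsub>M\<^esub> x) (UnitOb M)"

locale weak_2_group = weak_monoidal_category M
  for M :: "('o, 'm, 'z) moncat_scheme" (structure) +
  assumes weakly_invertible: "x \<in> Ob M \<Longrightarrow> \<exists>y. weak_inverse M x y"
    and all_iso: "f \<in> Ar M \<Longrightarrow> iso_arr M f"

locale adjunction = weak_monoidal_category M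
  for M :: "('o, 'm, 'z) moncat_scheme" (structure) +
  fixes x x' :: 'o and i e :: 'm
  assumes x_Ob: "x \<in> Ob M"
    and x'_Ob: "x' \<in> Ob M"
    and i_hom: "i \<in> hom M (UnitOb M) (x \<odot> x')"
    and e_hom: "e \<in> hom M (x' \<odot> x) (UnitOb M)"
    and zigzag_1: "(Ident M x \<otimes> e) \<cdot> Assoc M x x' x \<cdot> (i \<otimes> Ident M x)
      = inv_arr M (RUnit M x) \<cdot> LUnit M x"
    and zigzag_2: "(e \<otimes> Ident M x') \<cdot> inv_arr M (Assoc M x' x x') \<cdot> (Ident M x' \<otimes> i)
      = inv_arr M (LUnit M x') \<cdot> RUnit M x'"

locale adjoint_equivalence = adjunction +
  assumes i_iso: "iso_arr M i"
    and e_iso: "iso_arr M e"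

record ('o, 'm) coh_moncat = "('o, 'm) moncat" +
  Dual :: "'o \<Rightarrow> 'o"
  AdjUnit :: "'o \<Rightarrow> 'm"
  AdjCounit :: "'o \<Rightarrow> 'm"

locale coherent_2_group = weak_monoidal_category M
  for M :: "('o, 'm, 'z) coh_moncat_scheme" (structure) +
  assumes all_iso: "f \<in> Ar M \<Longrightarrow> iso_arr M f"
    and adj_equiv: "x \<in> Ob M
      \<Longrightarrow> adjoint_equivalence M x (Dual M x) (AdjUnit M x) (AdjCounit M x)"

text \<open>
  The type parameters \<open>'o\<close> and \<open>'m\<close> play the role of a universe: they bound the sets of objects
  and morphisms of the 2-groups considered.
\<close>

definition W2G ::
  "(('o, 'm) moncat, ('o, 'm, 'o, 'm) monfun, ('o, 'm, 'o, 'm) montrans) two_cat" where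
  "W2G =
    \<lparr> Ob0 = {C. weak_2_group C},
      Hom = monfun_cat,
      Unit1 = id_monfun,
      Comp1 = (\<lambda>C D E. comp_monfun C E),
      Comp2 = (\<lambda>C D E. hcomp_montrans C E) \<rparr>"

abbreviation underlying :: "('o, 'm) coh_moncat \<Rightarrow> ('o, 'm) moncat" where
  "underlying \<equiv> moncat.truncate"

definition C2G ::
  "(('o, 'm) coh_moncat, ('o, 'm, 'o, 'm) monfun, ('o, 'm, 'o, 'm) montrans) two_cat" where
  "C2G =
    \<lparr> Ob0 = {C. coherent_2_group C},
      Hom = (\<lambda>C D. monfun_cat (underlying C) (underlying D)),
      Unit1 = (\<lambda>C. id_monfun (underlying C)),
      Comp1 = (\<lambda>C D E. comp_monfun (underlying C) (underlying E)),
      Comp2 = (\<lambda>C D E. hcomp_montrans (underlying C) (underlying E)) \<rparr>"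

definition forget_C2G ::
  "(('o, 'm) coh_moncat, ('o, 'm, 'o, 'm) monfun, ('o, 'm, 'o, 'm) montrans,
    ('o, 'm) moncat, ('o, 'm, 'o, 'm) monfun, ('o, 'm, 'o, 'm) montrans) two_map" where
  "forget_C2G = \<lparr> Map0 = underlying, Map1 = (\<lambda>C D F. F), Map2 = (\<lambda>C D \<theta>. \<theta>) \<rparr>"

end

theory Submission
  imports Defs
begin

text \<open>
  A 2-group \<open>C\<close> and the image of \<open>C\<close> under the composite of \<open>imp\<close> and the forgetful 2-functor
  (in either order) have the same underlying weak monoidal category. Since 1-cells and 2-cells of
  \<open>C2G\<close> ignore the chosen adjoint equivalences, the identity monoidal functor is therefore a 1-cell
  between the two, also when they differ as coherent 2-groups. These identities are strictly
  natural and inverse to each other. The remaining work is that \<open>W2G\<close>, and hence \<open>C2G\<close>, is a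
  2-category.
\<close>

section \<open>Categories and functors\<close>

text \<open>Nothing is known about \<open>imp\<close> outside the carriers. So even for the
  composite on \<open>W2G\<close>, which fixes all objects and cells, HOL equality with the identity
  2-functor cannot be expected, and for the composite on \<open>C2G\<close> objects may genuinely
  change. Both cases are therefore instances of one statement about two 2-functors into a 2-category
  \<open>A\<close> that agree on carriers once a map \<open>u\<close> has forgotten part of each
  object: \<open>u\<close> is \<open>underlying\<close> for \<open>C2G\<close> and the identity map
  for \<open>W2G\<close>. The 2-category laws are HOL equalities between records. They become
  provable because the components of 1-cells and 2-cells are extensional and because composition of
  monoidal functors is strictly unital and associative. The main calculation is that a composite of
  monoidal functors is again monoidal; it is carried out by rewriting with naturality squares inside
  right-nested composites.\<close>

lemma homI: "f \<in> Ar C \<Longrightarrow> Dom C f = x \<Longrightarrow> Cod C f = y \<Longrightarrow> f \<in> hom C x y"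
  by (simp add: hom_def)

lemma homD:
  assumes "f \<in> hom C x y"
  shows "f \<in> Ar C" "Dom C f = x" "Cod C f = y"
  using assms by (auto simp: hom_def)

context category
begin

declare Dom_Ob [simp] Cod_Ob [simp]

lemma Ident_Ar [simp]:
  assumes "x \<in> Ob C"
  shows "Ident C x \<in> Ar C" "Dom C (Ident C x) = x" "Cod C (Ident C x) = x"
  using Ident_hom[OF assms] by (simp_all add: hom_def)

lemma Comp_Ar [simp]:
  assumes "f \<in> Ar C" "g \<in> Ar C" "Cod C f = Dom C g"
  shows "g \<cdot> f \<in> Ar C" "Dom C (g \<cdot> f) = Dom C f" "Cod C (g \<cdot> f) = Cod C g"
  using Comp_hom[of f "Dom C f" "Dom C g" g "Cod C g"] assms by (simp_all add: hom_def)

lemma Comp_Ident [simp]: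
  assumes "f \<in> Ar C"
  shows "Cod C f = y \<Longrightarrow> Ident C y \<cdot> f = f" "Dom C f = x \<Longrightarrow> f \<cdot> Ident C x = f"
  using assms Ident_left Ident_right by (auto simp: hom_def)

text \<open>Brings every composite into right-nested form. The typing conditions are equations
  between domains and codomains, which simp can discharge, whereas \<open>Comp_assoc\<close>
  mentions objects that do not occur in its equation.\<close>

lemma Comp_assoc_Ar [simp]:
  assumes "f \<in> Ar C" "g \<in> Ar C" "h \<in> Ar C" "Cod C f = Dom C g" "Cod C g = Dom C h"
  shows "(h \<cdot> g) \<cdot> f = h \<cdot> (g \<cdot> f)"
  using Comp_assoc[of f "Dom C f" "Dom C g" g "Dom C h" h "Cod C h"] assms by (simp add: hom_def)

text \<open>Rewriting with \<open>e\<close> inside a right-associated composite.\<close>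

lemma Comp_square:
  assumes e: "g \<cdot> f = g' \<cdot> f'"
    and "f \<in> Ar C" "g \<in> Ar C" "Cod C f = Dom C g"
    and "f' \<in> Ar C" "g' \<in> Ar C" "Cod C f' = Dom C g'"
    and "k \<in> Ar C" "Cod C k = Dom C f" "Cod C k = Dom C f'"
  shows "g \<cdot> (f \<cdot> k) = g' \<cdot> (f' \<cdot> k)"
proof -
  have "g \<cdot> (f \<cdot> k) = (g \<cdot> f) \<cdot> k"
    using assms(2-) by simp
  also have "\<dots> = (g' \<cdot> f') \<cdot> k"
    by (simp only: e)
  also have "\<dots> = g' \<cdot> (f' \<cdot> k)"
    using assms(2-) by simp
  finally show ?thesis .
qed

text \<open>The associator law of a monoidal functor equates two composites of three arrows. When a
  further arrow \<open>k\<close> precedes them, right nesting hides the left side of the law as a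
  subterm, so the law is needed with \<open>k\<close> appended.\<close>

lemma Comp_hexagon:
  assumes e: "h \<cdot> (g \<cdot> f) = h' \<cdot> (g' \<cdot> f')"
    and "f \<in> Ar C" "g \<in> Ar C" "h \<in> Ar C" "Cod C f = Dom C g" "Cod C g = Dom C h"
    and "f' \<in> Ar C" "g' \<in> Ar C" "h' \<in> Ar C" "Cod C f' = Dom C g'" "Cod C g' = Dom C h'"
    and "k \<in> Ar C" "Cod C k = Dom C f" "Cod C k = Dom C f'"
  shows "h \<cdot> (g \<cdot> (f \<cdot> k)) = h' \<cdot> (g' \<cdot> (f' \<cdot> k))"
  using Comp_square[OF e, of k] assms(2-) by simp

lemma inverse_arrows_Ident: "x \<in> Ob C \<Longrightarrow> inverse_arrows C (Ident C x) (Ident C x)"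
  by (simp add: inverse_arrows_def hom_def)

lemma iso_Ident [simp]: "x \<in> Ob C \<Longrightarrow> iso_arr C (Ident C x)"
  unfolding iso_arr_def by (blast intro: inverse_arrows_Ident)

lemma iso_Comp [simp]:
  assumes "iso_arr C f" "iso_arr C g" "Cod C f = Dom C g"
  shows "iso_arr C (g \<cdot> f)"
proof -
  obtain f' g' where f': "inverse_arrows C f f'" and g': "inverse_arrows C g g'"
    using assms by (auto simp: iso_arr_def)
  then have t: "f \<in> Ar C" "g \<in> Ar C" "f' \<in> Ar C" "g' \<in> Ar C" "Dom C f' = Cod C f" "Cod C f' = Dom C f"
      "Dom C g' = Cod C g" "Cod C g' = Dom C g"
    and i: "f' \<cdot> f = Ident C (Dom C f)" "f \<cdot> f' = Ident C (Cod C f)"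
      "g' \<cdot> g = Ident C (Dom C g)" "g \<cdot> g' = Ident C (Cod C g)"
    by (auto simp: inverse_arrows_def hom_def)
  have "(f' \<cdot> g') \<cdot> (g \<cdot> f) = f' \<cdot> ((g' \<cdot> g) \<cdot> f)"
    using t assms(3) by simp
  then have 1: "(f' \<cdot> g') \<cdot> (g \<cdot> f) = Ident C (Dom C f)"
    using t i assms(3) by (metis Comp_Ident(1))
  have "(g \<cdot> f) \<cdot> (f' \<cdot> g') = g \<cdot> ((f \<cdot> f') \<cdot> g')"
    using t assms(3) by simp
  then have 2: "(g \<cdot> f) \<cdot> (f' \<cdot> g') = Ident C (Cod C g)"
    using t i assms(3) by (metis Comp_Ident(1))
  have "inverse_arrows C (g \<cdot> f) (f' \<cdot> g')"
    unfolding inverse_arrows_def using 1 2 t assms(3) by (simp add: hom_def del: Comp_assoc_Ar)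
  then show ?thesis
    by (auto simp: iso_arr_def)
qed

text \<open>Needed because the unit of an adjoint equivalence starts at the unit object, whereas
  \<open>weak_inverse\<close> asks for an isomorphism ending there.\<close>

lemma isomorphic_sym:
  assumes "isomorphic C x y"
  shows "isomorphic C y x"
proof -
  obtain f g where "f \<in> hom C x y" "inverse_arrows C f g"
    using assms by (auto simp: isomorphic_def iso_arr_def)
  then have "g \<in> hom C y x" "inverse_arrows C g f"
    by (auto simp: inverse_arrows_def hom_def)
  then show ?thesis
    by (auto simp: isomorphic_def iso_arr_def)
qed

end

context cat_functor
begin

lemma map_Ar [simp]:
  assumes "f \<in> Ar C"
  shows "Fa f \<in> Ar D" "Dom D (Fa f) = Fo (Dom C f)" "Cod D (Fa f) = Fo (Cod C f)"
  using map_hom[of f "Dom C f" "Cod C f"] assms by (simp_all add: hom_def)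

declare map_Ob [simp] map_Ident [simp]

text \<open>Kept out of the simp set because both directions are used: expanding the image of a
  coherence law, and folding images back into the image of a composite.\<close>

lemma map_Comp_Ar:
  assumes "f \<in> Ar C" "g \<in> Ar C" "Cod C f = Dom C g"
  shows "Fa (g \<cdot>\<^bsub>C\<^esub> f) = Fa g \<cdot>\<^bsub>D\<^esub> Fa f"
  using map_Comp[of f "Dom C f" "Dom C g" g "Cod C g"] assms by (simp add: hom_def)

text \<open>With the functor distributed over both composites, the image of a commuting square has
  the shape that \<open>Comp_square\<close> expects.\<close>

lemma map_square:
  assumes e: "g \<cdot>\<^bsub>C\<^esub> f = g' \<cdot>\<^bsub>C\<^esub> f'"
    and "f \<in> Ar C" "g \<in> Ar C" "Cod C f = Dom C g"
    and "f' \<in> Ar C" "g' \<in> Ar C" "Cod C f' = Dom C g'"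
  shows "Fa g \<cdot>\<^bsub>D\<^esub> Fa f = Fa g' \<cdot>\<^bsub>D\<^esub> Fa f'"
  using e map_Comp_Ar[OF assms(2-4)] map_Comp_Ar[OF assms(5-7)] by simp

lemma iso_map:
  assumes "iso_arr C f"
  shows "iso_arr D (Fa f)"
proof -
  obtain g where g: "inverse_arrows C f g"
    using assms by (auto simp: iso_arr_def)
  then have "Fa g \<cdot>\<^bsub>D\<^esub> Fa f = Fa (Ident C (Dom C f))" "Fa f \<cdot>\<^bsub>D\<^esub> Fa g = Fa (Ident C (Cod C f))"
    by (auto simp: inverse_arrows_def hom_def simp flip: map_Comp_Ar)
  then have "inverse_arrows D (Fa f) (Fa g)"
    using g by (auto simp: inverse_arrows_def hom_def)
  then show ?thesis
    by (auto simp: iso_arr_def)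
qed

end

lemma cat_functor_id:
  assumes "category C"
  shows "cat_functor C C (\<lambda>x. x) (\<lambda>f. f)"
proof -
  interpret category C by fact
  show ?thesis
    by unfold_locales simp_all
qed

lemma category_prod_cat:
  assumes "category C" "category D"
  shows "category (prod_cat C D)"
proof -
  interpret C: category C by fact
  interpret D: category D by fact
  show ?thesis
    by unfold_locales (auto simp: prod_cat_def hom_def)
qed

section \<open>Monoidal functors and transformations\<close>

context weak_monoidal_category
begin

text \<open>The axiom \<open>tensor_functor\<close> speaks of pairs in a product category; from here
  on it is used in curried form.\<close>

lemma TensOb_Ob [simp]: "x \<in> Ob M \<Longrightarrow> y \<in> Ob M \<Longrightarrow> x \<odot> y \<in> Ob M"
  using cat_functor.map_Ob[OF tensor_functor, of "(x, y)"] by (simp add: prod_cat_def)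

lemma TensAr_Ar [simp]:
  assumes "f \<in> Ar M" "g \<in> Ar M"
  shows "f \<otimes> g \<in> Ar M" "Dom M (f \<otimes> g) = Dom M f \<odot> Dom M g"
    "Cod M (f \<otimes> g) = Cod M f \<odot> Cod M g"
  using cat_functor.map_hom[OF tensor_functor, of "(f, g)" "(Dom M f, Dom M g)" "(Cod M f, Cod M g)"] assms
  by (simp_all add: prod_cat_def hom_def)

lemma TensAr_Ident [simp]:
  "x \<in> Ob M \<Longrightarrow> y \<in> Ob M \<Longrightarrow> Ident M x \<otimes> Ident M y = Ident M (x \<odot> y)"
  using cat_functor.map_Ident[OF tensor_functor, of "(x, y)"] by (simp add: prod_cat_def)

lemma TensAr_Comp:
  assumes "f \<in> Ar M" "f' \<in> Ar M" "Cod M f = Dom M f'" "g \<in> Ar M" "g' \<in> Ar M" "Cod M g = Dom M g'"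
  shows "(f' \<cdot> f) \<otimes> (g' \<cdot> g) = (f' \<otimes> g') \<cdot> (f \<otimes> g)"
  using cat_functor.map_Comp[OF tensor_functor, of "(f, g)" "(Dom M f, Dom M g)" "(Cod M f, Cod M g)"
    "(f', g')" "(Cod M f', Cod M g')"] assms
  by (simp add: prod_cat_def hom_def)

text \<open>The interchange law with \<open>Ident M x\<close> factored as its own composite with
  itself, a factorisation that rewriting with \<open>TensAr_Comp\<close> would not find.\<close>

lemma TensAr_Comp_Ident:
  assumes "f \<in> Ar M" "f' \<in> Ar M" "Cod M f = Dom M f'" "x \<in> Ob M"
  shows "(f' \<cdot> f) \<otimes> Ident M x = (f' \<otimes> Ident M x) \<cdot> (f \<otimes> Ident M x)"
    "Ident M x \<otimes> (f' \<cdot> f) = (Ident M x \<otimes> f') \<cdot> (Ident M x \<otimes> f)"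
  using assms TensAr_Comp[of f f' "Ident M x" "Ident M x"] TensAr_Comp[of "Ident M x" "Ident M x" f f']
  by simp_all

declare UnitOb_Ob [simp]

lemma Assoc_Ar [simp]:
  assumes "x \<in> Ob M" "y \<in> Ob M" "z \<in> Ob M"
  shows "Assoc M x y z \<in> Ar M" "Dom M (Assoc M x y z) = (x \<odot> y) \<odot> z"
    "Cod M (Assoc M x y z) = x \<odot> (y \<odot> z)"
  using Assoc_hom[OF assms] by (simp_all add: hom_def)

lemma LUnit_Ar [simp]:
  assumes "x \<in> Ob M"
  shows "LUnit M x \<in> Ar M" "Dom M (LUnit M x) = UnitOb M \<odot> x" "Cod M (LUnit M x) = x"
  using LUnit_hom[OF assms] by (simp_all add: hom_def)

lemma RUnit_Ar [simp]:
  assumes "x \<in> Ob M"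
  shows "RUnit M x \<in> Ar M" "Dom M (RUnit M x) = x \<odot> UnitOb M" "Cod M (RUnit M x) = x"
  using RUnit_hom[OF assms] by (simp_all add: hom_def)

end

context weak_monoidal_functor
begin

declare FunMult_iso [simp] FunUnit_iso [simp]

lemma FunMult_Ar [simp]:
  assumes "x \<in> Ob C" "y \<in> Ob C"
  shows "FunMult F x y \<in> Ar D" "Dom D (FunMult F x y) = FunOb F x \<odot>\<^bsub>D\<^esub> FunOb F y"
    "Cod D (FunMult F x y) = FunOb F (x \<odot>\<^bsub>C\<^esub> y)"
  using FunMult_hom[OF assms] by (simp_all add: hom_def)

lemma FunUnit_Ar [simp]:
  shows "FunUnit F \<in> Ar D" "Dom D (FunUnit F) = UnitOb D" "Cod D (FunUnit F) = FunOb F (UnitOb C)"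
  using FunUnit_hom by (simp_all add: hom_def)

lemma FunMult_natural_Ar:
  assumes "f \<in> Ar C" "g \<in> Ar C" "Cod C f = x" "Cod C g = y"
  shows "FunMult F x y \<cdot>\<^bsub>D\<^esub> (FunAr F f \<otimes>\<^bsub>D\<^esub> FunAr F g)
    = FunAr F (f \<otimes>\<^bsub>C\<^esub> g) \<cdot>\<^bsub>D\<^esub> FunMult F (Dom C f) (Dom C g)"
  using FunMult_natural[of f "Dom C f" x g "Dom C g" y] assms by (simp add: hom_def)

end

context weak_monoidal_nat_trans
begin

lemma Cmpt_Ar [simp]:
  assumes "x \<in> Ob C"
  shows "Cmpt \<theta> x \<in> Ar D" "Dom D (Cmpt \<theta> x) = FunOb (Src \<theta>) x" "Cod D (Cmpt \<theta> x) = FunOb (Tgt \<theta>) x"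
  using Cmpt_hom[OF assms] by (simp_all add: hom_def)

lemma Cmpt_natural_Ar:
  assumes "f \<in> Ar C" "Cod C f = y"
  shows "Cmpt \<theta> y \<cdot>\<^bsub>D\<^esub> FunAr (Src \<theta>) f = FunAr (Tgt \<theta>) f \<cdot>\<^bsub>D\<^esub> Cmpt \<theta> (Dom C f)"
  using Cmpt_natural[of f "Dom C f" y] assms by (simp add: hom_def)

end

text \<open>The three function components are extensional, so their values on the carriers determine
  them. This is how the unit and associativity laws become HOL equalities.\<close>

lemma monfun_eqI:
  assumes "weak_monoidal_functor C D F" "weak_monoidal_functor C D G"
    and "\<And>x. x \<in> Ob C \<Longrightarrow> FunOb F x = FunOb G x"
    and "\<And>f. f \<in> Ar C \<Longrightarrow> FunAr F f = FunAr G f"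
    and "\<And>x y. x \<in> Ob C \<Longrightarrow> y \<in> Ob C \<Longrightarrow> FunMult F x y = FunMult G x y"
    and "FunUnit F = FunUnit G"
  shows "F = G"
proof -
  interpret F: weak_monoidal_functor C D F by fact
  interpret G: weak_monoidal_functor C D G by fact
  have "FunOb F = FunOb G"
    using F.FunOb_ext G.FunOb_ext assms(3) by (rule extensionalityI)
  moreover have "FunAr F = FunAr G"
    using F.FunAr_ext G.FunAr_ext assms(4) by (rule extensionalityI)
  \<comment> \<open>The carrier of the multiplication is a set of pairs, so extensionality is
    available for the uncurried function; the curried equality is recovered from it.\<close>
  moreover have "case_prod (FunMult F) = case_prod (FunMult G)"
    using F.FunMult_ext G.FunMult_ext by (rule extensionalityI) (auto simp: assms(5))
  then have "FunMult F = FunMult G"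
    by (metis curry_case_prod)
  ultimately show ?thesis
    using assms(6) by simp
qed

lemma montrans_eqI:
  assumes "weak_monoidal_nat_trans C D \<theta>" "weak_monoidal_nat_trans C D \<eta>"
    and "Src \<theta> = Src \<eta>" "Tgt \<theta> = Tgt \<eta>"
    and "\<And>x. x \<in> Ob C \<Longrightarrow> Cmpt \<theta> x = Cmpt \<eta> x"
  shows "\<theta> = \<eta>"
proof -
  have "Cmpt \<theta> = Cmpt \<eta>"
    using assms weak_monoidal_nat_trans.Cmpt_ext extensionalityI by metis
  then show ?thesis
    using assms(3,4) by simp
qed

section \<open>Identity and composite monoidal functors\<close>

lemma weak_monoidal_functor_id:
  assumes "weak_monoidal_category C"
  shows "weak_monoidal_functor C C (id_monfun C)"
proof -
  interpret C: weak_monoidal_category C by fact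
  show ?thesis
    by unfold_locales
      (auto simp: id_monfun_def hom_def extensional_def)
qed

lemma comp_monfun_simps [simp]:
  "x \<in> Ob C \<Longrightarrow> FunOb (comp_monfun C E G F) x = FunOb G (FunOb F x)"
  "f \<in> Ar C \<Longrightarrow> FunAr (comp_monfun C E G F) f = FunAr G (FunAr F f)"
  "x \<in> Ob C \<Longrightarrow> y \<in> Ob C \<Longrightarrow> FunMult (comp_monfun C E G F) x y
    = FunAr G (FunMult F x y) \<cdot>\<^bsub>E\<^esub> FunMult G (FunOb F x) (FunOb F y)"
  "FunUnit (comp_monfun C E G F) = FunAr G (FunUnit F) \<cdot>\<^bsub>E\<^esub> FunUnit G"
  by (simp_all add: comp_monfun_def)

text \<open>In each coherence law the multiplication of \<open>G\<close> is moved past an image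
  under \<open>G\<close> by its naturality. Then the image under \<open>G\<close> of the law for
  \<open>F\<close> applies, and what remains is the law for \<open>G\<close>.\<close>

lemma weak_monoidal_functor_comp:
  assumes "weak_monoidal_functor C D F" "weak_monoidal_functor D E G"
  shows "weak_monoidal_functor C E (comp_monfun C E G F)"
proof -
  interpret F: weak_monoidal_functor C D F by fact
  interpret G: weak_monoidal_functor D E G by fact
  show ?thesis
  proof
    show "FunOb (comp_monfun C E G F) \<in> extensional (Ob C)"
      "FunAr (comp_monfun C E G F) \<in> extensional (Ar C)"
      "case_prod (FunMult (comp_monfun C E G F)) \<in> extensional (Ob C \<times> Ob C)"
      by (auto simp: comp_monfun_def extensional_def)
  next
    fix x assume "x \<in> Ob C"
    then show "FunOb (comp_monfun C E G F) x \<in> Ob E"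
      "FunAr (comp_monfun C E G F) (Ident C x) = Ident E (FunOb (comp_monfun C E G F) x)"
      by simp_all
  next
    fix f x y assume "f \<in> hom C x y"
    then show "FunAr (comp_monfun C E G F) f
        \<in> hom E (FunOb (comp_monfun C E G F) x) (FunOb (comp_monfun C E G F) y)"
      by (auto simp: hom_def)
  next
    fix f x y g z assume "f \<in> hom C x y" "g \<in> hom C y z"
    then show "FunAr (comp_monfun C E G F) (g \<cdot>\<^bsub>C\<^esub> f)
        = FunAr (comp_monfun C E G F) g \<cdot>\<^bsub>E\<^esub> FunAr (comp_monfun C E G F) f"
      by (auto simp: hom_def F.map_Comp_Ar G.map_Comp_Ar)
  next
    fix x y assume "x \<in> Ob C" "y \<in> Ob C"
    then show "FunMult (comp_monfun C E G F) x y
        \<in> hom E (FunOb (comp_monfun C E G F) x \<odot>\<^bsub>E\<^esub> FunOb (comp_monfun C E G F) y)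
            (FunOb (comp_monfun C E G F) (x \<odot>\<^bsub>C\<^esub> y))"
      and "iso_arr E (FunMult (comp_monfun C E G F) x y)"
      by (simp_all add: hom_def G.iso_map)
  next
    show "FunUnit (comp_monfun C E G F) \<in> hom E (UnitOb E) (FunOb (comp_monfun C E G F) (UnitOb C))"
      and "iso_arr E (FunUnit (comp_monfun C E G F))"
      by (simp_all add: hom_def G.iso_map)
  next
    fix f x x' g y y' assume "f \<in> hom C x x'" "g \<in> hom C y y'"
    note t [simp] = homD[OF this(1)] homD[OF this(2)]
    have [simp]: "x \<in> Ob C" "y \<in> Ob C" "x' \<in> Ob C" "y' \<in> Ob C"
      using F.C.Dom_Ob[OF t(1)] F.C.Dom_Ob[OF t(4)] F.C.Cod_Ob[OF t(1)] F.C.Cod_Ob[OF t(4)] by simp_all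
    have F: "FunAr G (FunMult F x' y') \<cdot>\<^bsub>E\<^esub> FunAr G (FunAr F f \<otimes>\<^bsub>D\<^esub> FunAr F g)
        = FunAr G (FunAr F (f \<otimes>\<^bsub>C\<^esub> g)) \<cdot>\<^bsub>E\<^esub> FunAr G (FunMult F x y)"
      by (rule G.map_square) (simp_all add: F.FunMult_natural_Ar)
    show "FunMult (comp_monfun C E G F) x' y'
          \<cdot>\<^bsub>E\<^esub> (FunAr (comp_monfun C E G F) f \<otimes>\<^bsub>E\<^esub> FunAr (comp_monfun C E G F) g)
        = FunAr (comp_monfun C E G F) (f \<otimes>\<^bsub>C\<^esub> g) \<cdot>\<^bsub>E\<^esub> FunMult (comp_monfun C E G F) x y"
      by (simp add: G.FunMult_natural_Ar G.D.Comp_square[OF F])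
  next
    fix x y z assume [simp]: "x \<in> Ob C" "y \<in> Ob C" "z \<in> Ob C"
    let ?i = "\<lambda>x. Ident D (FunOb F x)"
    \<comment> \<open>Naturality of the multiplication of \<open>G\<close> at
      \<open>FunMult F x y\<close> paired with an identity: it separates the images under
      \<open>G\<close> from the multiplications of \<open>G\<close>. \<open>n2\<close> does the same
      on the other side of the associator.\<close>
    have n1: "FunMult G (FunOb F (x \<odot>\<^bsub>C\<^esub> y)) (FunOb F z)
          \<cdot>\<^bsub>E\<^esub> (FunAr G (FunMult F x y) \<otimes>\<^bsub>E\<^esub> Ident E (FunOb G (FunOb F z)))
        = FunAr G (FunMult F x y \<otimes>\<^bsub>D\<^esub> ?i z)
          \<cdot>\<^bsub>E\<^esub> FunMult G (FunOb F x \<odot>\<^bsub>D\<^esub> FunOb F y) (FunOb F z)"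
      using G.FunMult_natural_Ar[OF _ _ refl refl, of "FunMult F x y" "?i z"] by simp
    have n2: "FunMult G (FunOb F x) (FunOb F (y \<odot>\<^bsub>C\<^esub> z))
          \<cdot>\<^bsub>E\<^esub> (Ident E (FunOb G (FunOb F x)) \<otimes>\<^bsub>E\<^esub> FunAr G (FunMult F y z))
        = FunAr G (?i x \<otimes>\<^bsub>D\<^esub> FunMult F y z)
          \<cdot>\<^bsub>E\<^esub> FunMult G (FunOb F x) (FunOb F y \<odot>\<^bsub>D\<^esub> FunOb F z)"
      using G.FunMult_natural_Ar[OF _ _ refl refl, of "?i x" "FunMult F y z"] by simp
    have F: "FunAr G (FunAr F (Assoc C x y z)) \<cdot>\<^bsub>E\<^esub> FunAr G (FunMult F (x \<odot>\<^bsub>C\<^esub> y) z)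
          \<cdot>\<^bsub>E\<^esub> FunAr G (FunMult F x y \<otimes>\<^bsub>D\<^esub> ?i z)
        = FunAr G (FunMult F x (y \<odot>\<^bsub>C\<^esub> z)) \<cdot>\<^bsub>E\<^esub> FunAr G (?i x \<otimes>\<^bsub>D\<^esub> FunMult F y z)
          \<cdot>\<^bsub>E\<^esub> FunAr G (Assoc D (FunOb F x) (FunOb F y) (FunOb F z))"
      using arg_cong[OF F.Assoc_compat[of x y z], of "FunAr G"] by (simp add: G.map_Comp_Ar)
    show "FunAr (comp_monfun C E G F) (Assoc C x y z) \<cdot>\<^bsub>E\<^esub> FunMult (comp_monfun C E G F) (x \<odot>\<^bsub>C\<^esub> y) z
          \<cdot>\<^bsub>E\<^esub> (FunMult (comp_monfun C E G F) x y \<otimes>\<^bsub>E\<^esub> Ident E (FunOb (comp_monfun C E G F) z))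
        = FunMult (comp_monfun C E G F) x (y \<odot>\<^bsub>C\<^esub> z)
          \<cdot>\<^bsub>E\<^esub> (Ident E (FunOb (comp_monfun C E G F) x) \<otimes>\<^bsub>E\<^esub> FunMult (comp_monfun C E G F) y z)
          \<cdot>\<^bsub>E\<^esub> Assoc E (FunOb (comp_monfun C E G F) x) (FunOb (comp_monfun C E G F) y)
              (FunOb (comp_monfun C E G F) z)"
      by (simp add: G.D.TensAr_Comp_Ident G.D.Comp_square[OF n1] G.D.Comp_square[OF n2]
          G.D.Comp_hexagon[OF F] G.Assoc_compat)
  next
    fix x assume [simp]: "x \<in> Ob C"
    let ?i = "Ident D (FunOb F x)"
    have n1: "FunMult G (FunOb F (UnitOb C)) (FunOb F x)
          \<cdot>\<^bsub>E\<^esub> (FunAr G (FunUnit F) \<otimes>\<^bsub>E\<^esub> Ident E (FunOb G (FunOb F x)))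
        = FunAr G (FunUnit F \<otimes>\<^bsub>D\<^esub> ?i) \<cdot>\<^bsub>E\<^esub> FunMult G (UnitOb D) (FunOb F x)"
      using G.FunMult_natural_Ar[OF _ _ refl refl, of "FunUnit F" ?i] by simp
    have n2: "FunMult G (FunOb F x) (FunOb F (UnitOb C))
          \<cdot>\<^bsub>E\<^esub> (Ident E (FunOb G (FunOb F x)) \<otimes>\<^bsub>E\<^esub> FunAr G (FunUnit F))
        = FunAr G (?i \<otimes>\<^bsub>D\<^esub> FunUnit F) \<cdot>\<^bsub>E\<^esub> FunMult G (FunOb F x) (UnitOb D)"
      using G.FunMult_natural_Ar[OF _ _ refl refl, of ?i "FunUnit F"] by simp
    \<comment> \<open>A unit law has a single arrow on its right side. Two identities pad it to
      three factors so that \<open>Comp_hexagon\<close> applies; simp removes them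
      afterwards.\<close>
    have l: "FunAr G (FunAr F (LUnit C x)) \<cdot>\<^bsub>E\<^esub> FunAr G (FunMult F (UnitOb C) x)
          \<cdot>\<^bsub>E\<^esub> FunAr G (FunUnit F \<otimes>\<^bsub>D\<^esub> ?i)
        = Ident E (FunOb G (FunOb F x)) \<cdot>\<^bsub>E\<^esub> Ident E (FunOb G (FunOb F x))
          \<cdot>\<^bsub>E\<^esub> FunAr G (LUnit D (FunOb F x))"
      using arg_cong[OF F.LUnit_compat[of x], of "FunAr G"] by (simp add: G.map_Comp_Ar)
    have r: "FunAr G (FunAr F (RUnit C x)) \<cdot>\<^bsub>E\<^esub> FunAr G (FunMult F x (UnitOb C))
          \<cdot>\<^bsub>E\<^esub> FunAr G (?i \<otimes>\<^bsub>D\<^esub> FunUnit F)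
        = Ident E (FunOb G (FunOb F x)) \<cdot>\<^bsub>E\<^esub> Ident E (FunOb G (FunOb F x))
          \<cdot>\<^bsub>E\<^esub> FunAr G (RUnit D (FunOb F x))"
      using arg_cong[OF F.RUnit_compat[of x], of "FunAr G"] by (simp add: G.map_Comp_Ar)
    show "FunAr (comp_monfun C E G F) (LUnit C x) \<cdot>\<^bsub>E\<^esub> FunMult (comp_monfun C E G F) (UnitOb C) x
          \<cdot>\<^bsub>E\<^esub> (FunUnit (comp_monfun C E G F) \<otimes>\<^bsub>E\<^esub> Ident E (FunOb (comp_monfun C E G F) x))
        = LUnit E (FunOb (comp_monfun C E G F) x)"
      by (simp add: G.D.TensAr_Comp_Ident G.D.Comp_square[OF n1] G.D.Comp_hexagon[OF l] G.LUnit_compat)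
    show "FunAr (comp_monfun C E G F) (RUnit C x) \<cdot>\<^bsub>E\<^esub> FunMult (comp_monfun C E G F) x (UnitOb C)
          \<cdot>\<^bsub>E\<^esub> (Ident E (FunOb (comp_monfun C E G F) x) \<otimes>\<^bsub>E\<^esub> FunUnit (comp_monfun C E G F))
        = RUnit E (FunOb (comp_monfun C E G F) x)"
      by (simp add: G.D.TensAr_Comp_Ident G.D.Comp_square[OF n2] G.D.Comp_hexagon[OF r] G.RUnit_compat)
  qed
qed

section \<open>The category of monoidal functors and monoidal transformations\<close>

lemma monfun_cat_simps [simp]:
  "F \<in> Ob (monfun_cat C D) \<longleftrightarrow> weak_monoidal_functor C D F"
  "\<theta> \<in> Ar (monfun_cat C D) \<longleftrightarrow> weak_monoidal_nat_trans C D \<theta>"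
  "Dom (monfun_cat C D) = Src"
  "Cod (monfun_cat C D) = Tgt"
  "Src (\<eta> \<cdot>\<^bsub>monfun_cat C D\<^esub> \<theta>) = Src \<theta>"
  "Tgt (\<eta> \<cdot>\<^bsub>monfun_cat C D\<^esub> \<theta>) = Tgt \<eta>"
  "x \<in> Ob C \<Longrightarrow> Cmpt (\<eta> \<cdot>\<^bsub>monfun_cat C D\<^esub> \<theta>) x = Cmpt \<eta> x \<cdot>\<^bsub>D\<^esub> Cmpt \<theta> x"
  "Src (Ident (monfun_cat C D) F) = F"
  "Tgt (Ident (monfun_cat C D) F) = F"
  "x \<in> Ob C \<Longrightarrow> Cmpt (Ident (monfun_cat C D) F) x = Ident D (FunOb F x)"
  by (simp_all add: monfun_cat_def)

lemma weak_monoidal_nat_trans_id: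
  assumes "weak_monoidal_functor C D F"
  shows "weak_monoidal_nat_trans C D (Ident (monfun_cat C D) F)"
proof -
  interpret weak_monoidal_functor C D F by fact
  show ?thesis
    by (intro weak_monoidal_nat_trans.intro weak_monoidal_nat_trans_axioms.intro)
      (use assms C.Dom_Ob C.Cod_Ob in \<open>auto simp: hom_def monfun_cat_def\<close>)
qed

text \<open>Each axiom follows by pasting the diagram for \<theta> to the one for \<eta>. For the
  tensor axiom the interchange law first splits a tensor product of two composites.\<close>

lemma weak_monoidal_nat_trans_comp:
  assumes "weak_monoidal_nat_trans C D \<theta>" "weak_monoidal_nat_trans C D \<eta>" "Tgt \<theta> = Src \<eta>"
  shows "weak_monoidal_nat_trans C D (\<eta> \<cdot>\<^bsub>monfun_cat C D\<^esub> \<theta>)"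
proof -
  interpret \<theta>: weak_monoidal_nat_trans C D \<theta> by fact
  interpret \<eta>: weak_monoidal_nat_trans C D \<eta> by fact
  note s [simp] = assms(3)
  show ?thesis
  proof (intro weak_monoidal_nat_trans.intro weak_monoidal_nat_trans_axioms.intro)
    show "weak_monoidal_functor C D (Src (\<eta> \<cdot>\<^bsub>monfun_cat C D\<^esub> \<theta>))"
      "weak_monoidal_functor C D (Tgt (\<eta> \<cdot>\<^bsub>monfun_cat C D\<^esub> \<theta>))"
      by (simp_all add: \<theta>.F.weak_monoidal_functor_axioms \<eta>.G.weak_monoidal_functor_axioms)
    show "Cmpt (\<eta> \<cdot>\<^bsub>monfun_cat C D\<^esub> \<theta>) \<in> extensional (Ob C)"
      by (simp add: monfun_cat_def)
  next
    fix x assume "x \<in> Ob C"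
    then show "Cmpt (\<eta> \<cdot>\<^bsub>monfun_cat C D\<^esub> \<theta>) x
        \<in> hom D (FunOb (Src (\<eta> \<cdot>\<^bsub>monfun_cat C D\<^esub> \<theta>)) x) (FunOb (Tgt (\<eta> \<cdot>\<^bsub>monfun_cat C D\<^esub> \<theta>)) x)"
      by (simp add: hom_def)
  next
    fix f x y assume "f \<in> hom C x y"
    note t [simp] = homD[OF this]
    have [simp]: "x \<in> Ob C" "y \<in> Ob C"
      using \<theta>.F.C.Dom_Ob[OF t(1)] \<theta>.F.C.Cod_Ob[OF t(1)] by simp_all
    have \<eta>: "Cmpt \<eta> y \<cdot>\<^bsub>D\<^esub> FunAr (Src \<eta>) f = FunAr (Tgt \<eta>) f \<cdot>\<^bsub>D\<^esub> Cmpt \<eta> x"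
      by (simp add: \<eta>.Cmpt_natural_Ar)
    show "Cmpt (\<eta> \<cdot>\<^bsub>monfun_cat C D\<^esub> \<theta>) y \<cdot>\<^bsub>D\<^esub> FunAr (Src (\<eta> \<cdot>\<^bsub>monfun_cat C D\<^esub> \<theta>)) f
        = FunAr (Tgt (\<eta> \<cdot>\<^bsub>monfun_cat C D\<^esub> \<theta>)) f \<cdot>\<^bsub>D\<^esub> Cmpt (\<eta> \<cdot>\<^bsub>monfun_cat C D\<^esub> \<theta>) x"
      by (simp add: \<theta>.Cmpt_natural_Ar \<theta>.F.D.Comp_square[OF \<eta>])
  next
    fix x y assume [simp]: "x \<in> Ob C" "y \<in> Ob C"
    have \<eta>: "FunMult (Tgt \<eta>) x y \<cdot>\<^bsub>D\<^esub> (Cmpt \<eta> x \<otimes>\<^bsub>D\<^esub> Cmpt \<eta> y)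
        = Cmpt \<eta> (x \<odot>\<^bsub>C\<^esub> y) \<cdot>\<^bsub>D\<^esub> FunMult (Src \<eta>) x y"
      by (simp add: \<eta>.Cmpt_tensor)
    have \<theta>: "FunMult (Src \<eta>) x y \<cdot>\<^bsub>D\<^esub> (Cmpt \<theta> x \<otimes>\<^bsub>D\<^esub> Cmpt \<theta> y)
        = Cmpt \<theta> (x \<odot>\<^bsub>C\<^esub> y) \<cdot>\<^bsub>D\<^esub> FunMult (Src \<theta>) x y"
      using \<theta>.Cmpt_tensor[of x y] by simp
    show "FunMult (Tgt (\<eta> \<cdot>\<^bsub>monfun_cat C D\<^esub> \<theta>)) x y
          \<cdot>\<^bsub>D\<^esub> (Cmpt (\<eta> \<cdot>\<^bsub>monfun_cat C D\<^esub> \<theta>) x \<otimes>\<^bsub>D\<^esub> Cmpt (\<eta> \<cdot>\<^bsub>monfun_cat C D\<^esub> \<theta>) y)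
        = Cmpt (\<eta> \<cdot>\<^bsub>monfun_cat C D\<^esub> \<theta>) (x \<odot>\<^bsub>C\<^esub> y) \<cdot>\<^bsub>D\<^esub> FunMult (Src (\<eta> \<cdot>\<^bsub>monfun_cat C D\<^esub> \<theta>)) x y"
      by (simp add: \<theta>.F.D.TensAr_Comp \<theta>.F.D.Comp_square[OF \<eta>] \<theta>)
  next
    show "Cmpt (\<eta> \<cdot>\<^bsub>monfun_cat C D\<^esub> \<theta>) (UnitOb C) \<cdot>\<^bsub>D\<^esub> FunUnit (Src (\<eta> \<cdot>\<^bsub>monfun_cat C D\<^esub> \<theta>))
        = FunUnit (Tgt (\<eta> \<cdot>\<^bsub>monfun_cat C D\<^esub> \<theta>))"
      using \<theta>.Cmpt_unit \<eta>.Cmpt_unit by simp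
  qed
qed

text \<open>The typing is carried by the cells: \<open>weak_monoidal_functor\<close> contains that
  \<open>C\<close> and \<open>D\<close> are weak monoidal categories, and if one of them is not,
  this category is empty.\<close>

lemma category_monfun_cat: "category (monfun_cat C D)"
proof
  fix \<theta> assume "\<theta> \<in> Ar (monfun_cat C D)"
  then interpret weak_monoidal_nat_trans C D \<theta> by simp
  show "Dom (monfun_cat C D) \<theta> \<in> Ob (monfun_cat C D)" "Cod (monfun_cat C D) \<theta> \<in> Ob (monfun_cat C D)"
    by (simp_all add: F.weak_monoidal_functor_axioms G.weak_monoidal_functor_axioms)
next
  fix F assume "F \<in> Ob (monfun_cat C D)"
  then show "Ident (monfun_cat C D) F \<in> hom (monfun_cat C D) F F"
    by (simp add: hom_def weak_monoidal_nat_trans_id)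
next
  fix \<theta> F G \<eta> H assume "\<theta> \<in> hom (monfun_cat C D) F G" "\<eta> \<in> hom (monfun_cat C D) G H"
  then show "\<eta> \<cdot>\<^bsub>monfun_cat C D\<^esub> \<theta> \<in> hom (monfun_cat C D) F H"
    by (auto simp: hom_def weak_monoidal_nat_trans_comp)
next
  fix \<theta> F G assume \<theta>: "\<theta> \<in> hom (monfun_cat C D) F G"
  then interpret weak_monoidal_nat_trans C D \<theta> by (simp add: hom_def)
  have [simp]: "F = Src \<theta>" "G = Tgt \<theta>"
    using \<theta> by (auto simp: hom_def)
  note [simp] = weak_monoidal_nat_trans_axioms F.weak_monoidal_functor_axioms G.weak_monoidal_functor_axioms
    weak_monoidal_nat_trans_id weak_monoidal_nat_trans_comp
  show "Ident (monfun_cat C D) G \<cdot>\<^bsub>monfun_cat C D\<^esub> \<theta> = \<theta>"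
    by (rule montrans_eqI[where C = C and D = D]) simp_all
  show "\<theta> \<cdot>\<^bsub>monfun_cat C D\<^esub> Ident (monfun_cat C D) F = \<theta>"
    by (rule montrans_eqI[where C = C and D = D]) simp_all
next
  fix \<theta> F G \<eta> H \<zeta> K
  assume "\<theta> \<in> hom (monfun_cat C D) F G" "\<eta> \<in> hom (monfun_cat C D) G H" "\<zeta> \<in> hom (monfun_cat C D) H K"
  then have t [simp]: "weak_monoidal_nat_trans C D \<theta>" "weak_monoidal_nat_trans C D \<eta>"
      "weak_monoidal_nat_trans C D \<zeta>" "Tgt \<theta> = Src \<eta>" "Tgt \<eta> = Src \<zeta>"
    by (auto simp: hom_def)
  interpret \<theta>: weak_monoidal_nat_trans C D \<theta> by fact
  interpret \<eta>: weak_monoidal_nat_trans C D \<eta> by fact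
  interpret \<zeta>: weak_monoidal_nat_trans C D \<zeta> by fact
  show "(\<zeta> \<cdot>\<^bsub>monfun_cat C D\<^esub> \<eta>) \<cdot>\<^bsub>monfun_cat C D\<^esub> \<theta>
      = \<zeta> \<cdot>\<^bsub>monfun_cat C D\<^esub> \<eta> \<cdot>\<^bsub>monfun_cat C D\<^esub> \<theta>"
    by (rule montrans_eqI[where C = C and D = D]) (simp_all add: weak_monoidal_nat_trans_comp)
qed

section \<open>Horizontal composition of monoidal transformations\<close>

lemma hcomp_montrans_simps [simp]:
  "Src (hcomp_montrans C E \<eta> \<theta>) = comp_monfun C E (Src \<eta>) (Src \<theta>)"
  "Tgt (hcomp_montrans C E \<eta> \<theta>) = comp_monfun C E (Tgt \<eta>) (Tgt \<theta>)"
  "x \<in> Ob C \<Longrightarrow> Cmpt (hcomp_montrans C E \<eta> \<theta>) x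
    = Cmpt \<eta> (FunOb (Tgt \<theta>) x) \<cdot>\<^bsub>E\<^esub> FunAr (Src \<eta>) (Cmpt \<theta> x)"
  by (simp_all add: hcomp_montrans_def)

text \<open>Every axiom combines the image under \<open>Src \<eta>\<close> of the law for \<theta>
  with naturality of \<eta>; the tensor and unit axioms also use the corresponding law for
  \<eta>.\<close>

lemma weak_monoidal_nat_trans_hcomp:
  assumes "weak_monoidal_nat_trans C D \<theta>" "weak_monoidal_nat_trans D E \<eta>"
  shows "weak_monoidal_nat_trans C E (hcomp_montrans C E \<eta> \<theta>)"
proof -
  interpret \<theta>: weak_monoidal_nat_trans C D \<theta> by fact
  interpret \<eta>: weak_monoidal_nat_trans D E \<eta> by fact
  show ?thesis
  proof (intro weak_monoidal_nat_trans.intro weak_monoidal_nat_trans_axioms.intro)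
    show "weak_monoidal_functor C E (Src (hcomp_montrans C E \<eta> \<theta>))"
      "weak_monoidal_functor C E (Tgt (hcomp_montrans C E \<eta> \<theta>))"
      using \<theta>.F.weak_monoidal_functor_axioms \<theta>.G.weak_monoidal_functor_axioms
        \<eta>.F.weak_monoidal_functor_axioms \<eta>.G.weak_monoidal_functor_axioms
      by (auto intro: weak_monoidal_functor_comp)
    show "Cmpt (hcomp_montrans C E \<eta> \<theta>) \<in> extensional (Ob C)"
      by (simp add: hcomp_montrans_def)
  next
    fix x assume "x \<in> Ob C"
    then show "Cmpt (hcomp_montrans C E \<eta> \<theta>) x
        \<in> hom E (FunOb (Src (hcomp_montrans C E \<eta> \<theta>)) x) (FunOb (Tgt (hcomp_montrans C E \<eta> \<theta>)) x)"
      by (simp add: hom_def)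
  next
    fix f x y assume "f \<in> hom C x y"
    note t [simp] = homD[OF this]
    have [simp]: "x \<in> Ob C" "y \<in> Ob C"
      using \<theta>.F.C.Dom_Ob[OF t(1)] \<theta>.F.C.Cod_Ob[OF t(1)] by simp_all
    have \<theta>: "FunAr (Src \<eta>) (Cmpt \<theta> y) \<cdot>\<^bsub>E\<^esub> FunAr (Src \<eta>) (FunAr (Src \<theta>) f)
        = FunAr (Src \<eta>) (FunAr (Tgt \<theta>) f) \<cdot>\<^bsub>E\<^esub> FunAr (Src \<eta>) (Cmpt \<theta> x)"
      by (rule \<eta>.F.map_square) (simp_all add: \<theta>.Cmpt_natural_Ar)
    have \<eta>: "Cmpt \<eta> (FunOb (Tgt \<theta>) y) \<cdot>\<^bsub>E\<^esub> FunAr (Src \<eta>) (FunAr (Tgt \<theta>) f)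
        = FunAr (Tgt \<eta>) (FunAr (Tgt \<theta>) f) \<cdot>\<^bsub>E\<^esub> Cmpt \<eta> (FunOb (Tgt \<theta>) x)"
      by (simp add: \<eta>.Cmpt_natural_Ar)
    show "Cmpt (hcomp_montrans C E \<eta> \<theta>) y \<cdot>\<^bsub>E\<^esub> FunAr (Src (hcomp_montrans C E \<eta> \<theta>)) f
        = FunAr (Tgt (hcomp_montrans C E \<eta> \<theta>)) f \<cdot>\<^bsub>E\<^esub> Cmpt (hcomp_montrans C E \<eta> \<theta>) x"
      by (simp add: \<theta> \<eta>.F.D.Comp_square[OF \<eta>])
  next
    fix x y assume [simp]: "x \<in> Ob C" "y \<in> Ob C"
    let ?x = "FunOb (Tgt \<theta>) x" and ?y = "FunOb (Tgt \<theta>) y"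
    \<comment> \<open>The squares are used in this order, after interchange has split the tensor
      product: the tensor law of \<eta>, naturality of the multiplication of
      \<open>Src \<eta>\<close>, naturality of \<eta> at the multiplication of
      \<open>Tgt \<theta>\<close>, and the image of the tensor law of \<theta>.\<close>
    have 1: "FunMult (Tgt \<eta>) ?x ?y \<cdot>\<^bsub>E\<^esub> (Cmpt \<eta> ?x \<otimes>\<^bsub>E\<^esub> Cmpt \<eta> ?y)
        = Cmpt \<eta> (?x \<odot>\<^bsub>D\<^esub> ?y) \<cdot>\<^bsub>E\<^esub> FunMult (Src \<eta>) ?x ?y"
      by (simp add: \<eta>.Cmpt_tensor)
    have 2: "FunMult (Src \<eta>) ?x ?y \<cdot>\<^bsub>E\<^esub> (FunAr (Src \<eta>) (Cmpt \<theta> x) \<otimes>\<^bsub>E\<^esub> FunAr (Src \<eta>) (Cmpt \<theta> y))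
        = FunAr (Src \<eta>) (Cmpt \<theta> x \<otimes>\<^bsub>D\<^esub> Cmpt \<theta> y)
          \<cdot>\<^bsub>E\<^esub> FunMult (Src \<eta>) (FunOb (Src \<theta>) x) (FunOb (Src \<theta>) y)"
      by (simp add: \<eta>.F.FunMult_natural_Ar)
    have 3: "FunAr (Tgt \<eta>) (FunMult (Tgt \<theta>) x y) \<cdot>\<^bsub>E\<^esub> Cmpt \<eta> (?x \<odot>\<^bsub>D\<^esub> ?y)
        = Cmpt \<eta> (FunOb (Tgt \<theta>) (x \<odot>\<^bsub>C\<^esub> y)) \<cdot>\<^bsub>E\<^esub> FunAr (Src \<eta>) (FunMult (Tgt \<theta>) x y)"
      by (simp add: \<eta>.Cmpt_natural_Ar)
    have 4: "FunAr (Src \<eta>) (FunMult (Tgt \<theta>) x y) \<cdot>\<^bsub>E\<^esub> FunAr (Src \<eta>) (Cmpt \<theta> x \<otimes>\<^bsub>D\<^esub> Cmpt \<theta> y)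
        = FunAr (Src \<eta>) (Cmpt \<theta> (x \<odot>\<^bsub>C\<^esub> y)) \<cdot>\<^bsub>E\<^esub> FunAr (Src \<eta>) (FunMult (Src \<theta>) x y)"
      by (rule \<eta>.F.map_square) (simp_all add: \<theta>.Cmpt_tensor)
    show "FunMult (Tgt (hcomp_montrans C E \<eta> \<theta>)) x y
          \<cdot>\<^bsub>E\<^esub> (Cmpt (hcomp_montrans C E \<eta> \<theta>) x \<otimes>\<^bsub>E\<^esub> Cmpt (hcomp_montrans C E \<eta> \<theta>) y)
        = Cmpt (hcomp_montrans C E \<eta> \<theta>) (x \<odot>\<^bsub>C\<^esub> y)
          \<cdot>\<^bsub>E\<^esub> FunMult (Src (hcomp_montrans C E \<eta> \<theta>)) x y"
      by (simp add: \<eta>.F.D.TensAr_Comp \<eta>.F.D.Comp_square[OF 1] 2 \<eta>.F.D.Comp_square[OF 3]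
          \<eta>.F.D.Comp_square[OF 4])
  next
    have 1: "FunAr (Src \<eta>) (Cmpt \<theta> (UnitOb C)) \<cdot>\<^bsub>E\<^esub> FunAr (Src \<eta>) (FunUnit (Src \<theta>))
        = FunAr (Src \<eta>) (FunUnit (Tgt \<theta>))"
      using \<theta>.Cmpt_unit by (simp flip: \<eta>.F.map_Comp_Ar)
    have 2: "Cmpt \<eta> (FunOb (Tgt \<theta>) (UnitOb C)) \<cdot>\<^bsub>E\<^esub> FunAr (Src \<eta>) (FunUnit (Tgt \<theta>))
        = FunAr (Tgt \<eta>) (FunUnit (Tgt \<theta>)) \<cdot>\<^bsub>E\<^esub> Cmpt \<eta> (UnitOb D)"
      by (simp add: \<eta>.Cmpt_natural_Ar)
    \<comment> \<open>Equation \<open>1\<close> has one arrow on its right side, so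
      \<open>Comp_square\<close> does not fit; the composite is regrouped by hand to expose its left
      side.\<close>
    have "Cmpt (hcomp_montrans C E \<eta> \<theta>) (UnitOb C) \<cdot>\<^bsub>E\<^esub> FunUnit (Src (hcomp_montrans C E \<eta> \<theta>))
        = Cmpt \<eta> (FunOb (Tgt \<theta>) (UnitOb C)) \<cdot>\<^bsub>E\<^esub>
          (FunAr (Src \<eta>) (Cmpt \<theta> (UnitOb C)) \<cdot>\<^bsub>E\<^esub> FunAr (Src \<eta>) (FunUnit (Src \<theta>)))
          \<cdot>\<^bsub>E\<^esub> FunUnit (Src \<eta>)"
      by simp
    also have "\<dots> = FunUnit (Tgt (hcomp_montrans C E \<eta> \<theta>))"
      unfolding 1 by (simp add: \<eta>.F.D.Comp_square[OF 2] \<eta>.Cmpt_unit)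
    finally show "Cmpt (hcomp_montrans C E \<eta> \<theta>) (UnitOb C)
          \<cdot>\<^bsub>E\<^esub> FunUnit (Src (hcomp_montrans C E \<eta> \<theta>))
        = FunUnit (Tgt (hcomp_montrans C E \<eta> \<theta>))" .
  qed
qed

text \<open>Preservation of composites is the interchange law between vertical and horizontal
  composition; it rests on naturality of the outer transformation.\<close>

lemma cat_functor_monfun_comp:
  "cat_functor (prod_cat (monfun_cat D E) (monfun_cat C D)) (monfun_cat C E)
    (\<lambda>(G, F). comp_monfun C E G F) (\<lambda>(\<eta>, \<theta>). hcomp_montrans C E \<eta> \<theta>)"
proof (intro cat_functor.intro cat_functor_axioms.intro category_prod_cat category_monfun_cat)
  fix p assume "p \<in> Ob (prod_cat (monfun_cat D E) (monfun_cat C D))"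
  then obtain G F where p [simp]: "p = (G, F)"
    and FG: "weak_monoidal_functor C D F" "weak_monoidal_functor D E G"
    by (auto simp: prod_cat_def)
  interpret F: weak_monoidal_functor C D F by fact
  interpret G: weak_monoidal_functor D E G by fact
  show "(case p of (G, F) \<Rightarrow> comp_monfun C E G F) \<in> Ob (monfun_cat C E)"
    using FG by (simp add: weak_monoidal_functor_comp)
  have "hcomp_montrans C E (Ident (monfun_cat D E) G) (Ident (monfun_cat C D) F)
      = Ident (monfun_cat C E) (comp_monfun C E G F)"
    by (rule montrans_eqI[where C = C and D = E])
      (use FG in \<open>simp_all add: weak_monoidal_nat_trans_hcomp[of C D _ E] weak_monoidal_nat_trans_id
        weak_monoidal_functor_comp\<close>)
  then show "(case Ident (prod_cat (monfun_cat D E) (monfun_cat C D)) p of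
        (\<eta>, \<theta>) \<Rightarrow> hcomp_montrans C E \<eta> \<theta>)
      = Ident (monfun_cat C E) (case p of (G, F) \<Rightarrow> comp_monfun C E G F)"
    by (simp add: prod_cat_def)
next
  fix p q r assume "p \<in> hom (prod_cat (monfun_cat D E) (monfun_cat C D)) q r"
  then show "(case p of (\<eta>, \<theta>) \<Rightarrow> hcomp_montrans C E \<eta> \<theta>)
      \<in> hom (monfun_cat C E) (case q of (G, F) \<Rightarrow> comp_monfun C E G F)
          (case r of (G, F) \<Rightarrow> comp_monfun C E G F)"
    by (auto simp: hom_def prod_cat_def weak_monoidal_nat_trans_hcomp)
next
  fix p q r p' r'
  assume "p \<in> hom (prod_cat (monfun_cat D E) (monfun_cat C D)) q r"
    "p' \<in> hom (prod_cat (monfun_cat D E) (monfun_cat C D)) r r'"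
  then obtain \<eta> \<theta> \<eta>' \<theta>' where p [simp]: "p = (\<eta>, \<theta>)" "p' = (\<eta>', \<theta>')"
    and t: "weak_monoidal_nat_trans D E \<eta>" "weak_monoidal_nat_trans C D \<theta>"
      "weak_monoidal_nat_trans D E \<eta>'" "weak_monoidal_nat_trans C D \<theta>'"
    and s [simp]: "Tgt \<eta> = Src \<eta>'" "Tgt \<theta> = Src \<theta>'"
    by (auto simp: hom_def prod_cat_def)
  interpret \<eta>: weak_monoidal_nat_trans D E \<eta> by fact
  interpret \<theta>: weak_monoidal_nat_trans C D \<theta> by fact
  interpret \<eta>': weak_monoidal_nat_trans D E \<eta>' by fact
  interpret \<theta>': weak_monoidal_nat_trans C D \<theta>' by fact
  have "hcomp_montrans C E (\<eta>' \<cdot>\<^bsub>monfun_cat D E\<^esub> \<eta>) (\<theta>' \<cdot>\<^bsub>monfun_cat C D\<^esub> \<theta>)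
      = hcomp_montrans C E \<eta>' \<theta>' \<cdot>\<^bsub>monfun_cat C E\<^esub> hcomp_montrans C E \<eta> \<theta>"
  proof (rule montrans_eqI[where C = C and D = E])
    fix x assume [simp]: "x \<in> Ob C"
    \<comment> \<open>Naturality of \<eta> at the arrow \<open>Cmpt \<theta>' x\<close> exchanges
      the two middle factors of the four.\<close>
    have n: "Cmpt \<eta> (FunOb (Tgt \<theta>') x) \<cdot>\<^bsub>E\<^esub> FunAr (Src \<eta>) (Cmpt \<theta>' x)
        = FunAr (Src \<eta>') (Cmpt \<theta>' x) \<cdot>\<^bsub>E\<^esub> Cmpt \<eta> (FunOb (Src \<theta>') x)"
      by (simp add: \<eta>.Cmpt_natural_Ar)
    show "Cmpt (hcomp_montrans C E (\<eta>' \<cdot>\<^bsub>monfun_cat D E\<^esub> \<eta>) (\<theta>' \<cdot>\<^bsub>monfun_cat C D\<^esub> \<theta>)) x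
        = Cmpt (hcomp_montrans C E \<eta>' \<theta>' \<cdot>\<^bsub>monfun_cat C E\<^esub> hcomp_montrans C E \<eta> \<theta>) x"
      by (simp add: \<eta>.F.map_Comp_Ar \<eta>.F.D.Comp_square[OF n])
  qed (use t in \<open>simp_all add: weak_monoidal_nat_trans_hcomp[of C D _ E] weak_monoidal_nat_trans_comp\<close>)
  then show "(case p' \<cdot>\<^bsub>prod_cat (monfun_cat D E) (monfun_cat C D)\<^esub> p of
        (\<eta>, \<theta>) \<Rightarrow> hcomp_montrans C E \<eta> \<theta>)
      = (case p' of (\<eta>, \<theta>) \<Rightarrow> hcomp_montrans C E \<eta> \<theta>)
          \<cdot>\<^bsub>monfun_cat C E\<^esub> (case p of (\<eta>, \<theta>) \<Rightarrow> hcomp_montrans C E \<eta> \<theta>)"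
    by (simp add: prod_cat_def)
qed

section \<open>Strict unit and associativity laws for functors and transformations\<close>

lemma id_monfun_simps [simp]:
  "x \<in> Ob C \<Longrightarrow> FunOb (id_monfun C) x = x"
  "f \<in> Ar C \<Longrightarrow> FunAr (id_monfun C) f = f"
  "x \<in> Ob C \<Longrightarrow> y \<in> Ob C \<Longrightarrow> FunMult (id_monfun C) x y = Ident C (x \<odot>\<^bsub>C\<^esub> y)"
  "FunUnit (id_monfun C) = Ident C (UnitOb C)"
  by (simp_all add: id_monfun_def)

lemma comp_monfun_id:
  assumes "weak_monoidal_functor C D F"
  shows "comp_monfun C D (id_monfun D) F = F" "comp_monfun C D F (id_monfun C) = F"
proof -
  interpret F: weak_monoidal_functor C D F by fact
  note [simp] = weak_monoidal_functor_comp[OF assms] weak_monoidal_functor_comp[OF _ assms]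
    weak_monoidal_functor_id F.C.weak_monoidal_category_axioms F.D.weak_monoidal_category_axioms assms
  show "comp_monfun C D (id_monfun D) F = F"
    by (rule monfun_eqI[where C = C and D = D]) simp_all
  show "comp_monfun C D F (id_monfun C) = F"
    by (rule monfun_eqI[where C = C and D = D]) simp_all
qed

text \<open>Once \<open>H\<close> is distributed over a composite, both bracketings have as
  multiplication the image of that of \<open>F\<close> under \<open>G\<close> and \<open>H\<close>,
  after the image of that of \<open>G\<close> under \<open>H\<close>, after that of
  \<open>H\<close>; the unit arrows behave alike.\<close>

lemma comp_monfun_assoc:
  assumes "weak_monoidal_functor B C F" "weak_monoidal_functor C D G" "weak_monoidal_functor D E H"
  shows "comp_monfun B E (comp_monfun C E H G) F = comp_monfun B E H (comp_monfun B D G F)"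
proof -
  interpret F: weak_monoidal_functor B C F by fact
  interpret G: weak_monoidal_functor C D G by fact
  interpret H: weak_monoidal_functor D E H by fact
  note c = weak_monoidal_functor_comp
  show ?thesis
    by (rule monfun_eqI[OF c[OF assms(1) c[OF assms(2,3)]] c[OF c[OF assms(1,2)] assms(3)]])
      (simp_all add: H.map_Comp_Ar)
qed

lemma hcomp_montrans_id:
  assumes "weak_monoidal_nat_trans C D \<theta>"
  shows "hcomp_montrans C D (Ident (monfun_cat D D) (id_monfun D)) \<theta> = \<theta>"
    "hcomp_montrans C D \<theta> (Ident (monfun_cat C C) (id_monfun C)) = \<theta>"
proof -
  interpret weak_monoidal_nat_trans C D \<theta> by fact
  note [simp] = weak_monoidal_nat_trans_hcomp[OF assms] weak_monoidal_nat_trans_hcomp[OF _ assms]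
    weak_monoidal_nat_trans_id weak_monoidal_functor_id
    F.C.weak_monoidal_category_axioms F.D.weak_monoidal_category_axioms assms
    comp_monfun_id[OF F.weak_monoidal_functor_axioms] comp_monfun_id[OF G.weak_monoidal_functor_axioms]
  show "hcomp_montrans C D (Ident (monfun_cat D D) (id_monfun D)) \<theta> = \<theta>"
    by (rule montrans_eqI[where C = C and D = D]) simp_all
  show "hcomp_montrans C D \<theta> (Ident (monfun_cat C C) (id_monfun C)) = \<theta>"
    by (rule montrans_eqI[where C = C and D = D]) simp_all
qed

text \<open>Sources and targets agree by strict associativity for functors. The components then
  differ by distributing \<open>FunAr (Src \<zeta>)\<close> over a composite.\<close>

lemma hcomp_montrans_assoc:
  assumes "weak_monoidal_nat_trans B C \<theta>" "weak_monoidal_nat_trans C D \<eta>"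
    "weak_monoidal_nat_trans D E \<zeta>"
  shows "hcomp_montrans B E (hcomp_montrans C E \<zeta> \<eta>) \<theta> = hcomp_montrans B E \<zeta> (hcomp_montrans B D \<eta> \<theta>)"
proof -
  interpret \<theta>: weak_monoidal_nat_trans B C \<theta> by fact
  interpret \<eta>: weak_monoidal_nat_trans C D \<eta> by fact
  interpret \<zeta>: weak_monoidal_nat_trans D E \<zeta> by fact
  note h = weak_monoidal_nat_trans_hcomp
  show ?thesis
  proof (rule montrans_eqI[OF h[OF assms(1) h[OF assms(2,3)]] h[OF h[OF assms(1,2)] assms(3)]])
    note c = comp_monfun_assoc
    show "Src (hcomp_montrans B E (hcomp_montrans C E \<zeta> \<eta>) \<theta>)
        = Src (hcomp_montrans B E \<zeta> (hcomp_montrans B D \<eta> \<theta>))"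
      using c[OF \<theta>.F.weak_monoidal_functor_axioms \<eta>.F.weak_monoidal_functor_axioms
        \<zeta>.F.weak_monoidal_functor_axioms] by simp
    show "Tgt (hcomp_montrans B E (hcomp_montrans C E \<zeta> \<eta>) \<theta>)
        = Tgt (hcomp_montrans B E \<zeta> (hcomp_montrans B D \<eta> \<theta>))"
      using c[OF \<theta>.G.weak_monoidal_functor_axioms \<eta>.G.weak_monoidal_functor_axioms
        \<zeta>.G.weak_monoidal_functor_axioms] by simp
  qed (simp add: \<zeta>.F.map_Comp_Ar)
qed

section \<open>2-categories\<close>

lemma two_category_W2G: "two_category W2G"
proof (rule two_category.intro)
  fix C D E :: "('o, 'm) moncat"
  show "cat_functor (prod_cat (Hom W2G D E) (Hom W2G C D)) (Hom W2G C E)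
      (\<lambda>(g, f). Comp1 W2G C D E g f) (\<lambda>(\<beta>, \<alpha>). Comp2 W2G C D E \<beta> \<alpha>)"
    by (simp add: W2G_def cat_functor_monfun_comp)
qed (auto simp: W2G_def category_monfun_cat weak_monoidal_functor_id weak_2_group_def
    comp_monfun_id comp_monfun_assoc hcomp_montrans_id hcomp_montrans_assoc)

text \<open>
  \<open>A\<close> is obtained from the 2-category \<open>B\<close> by attaching extra data to the objects,
  which \<open>u\<close> forgets.
\<close>

locale two_cat_pullback = B: two_category B
  for A :: "('a, 'f, 't) two_cat" and B :: "('b, 'f, 't) two_cat" and u :: "'a \<Rightarrow> 'b" +
  assumes u_Ob: "x \<in> Ob0 A \<Longrightarrow> u x \<in> Ob0 B"
    and Hom_u: "Hom A = (\<lambda>x y. Hom B (u x) (u y))"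
    and Unit1_u: "Unit1 A = (\<lambda>x. Unit1 B (u x))"
    and Comp1_u: "Comp1 A = (\<lambda>x y z. Comp1 B (u x) (u y) (u z))"
    and Comp2_u: "Comp2 A = (\<lambda>x y z. Comp2 B (u x) (u y) (u z))"
begin

text \<open>These are equations between functions without membership conditions, so simp translates
  every cell operation of \<open>A\<close> into one of \<open>B\<close> at once.\<close>

lemmas u_simps = Hom_u Unit1_u Comp1_u Comp2_u

lemma two_category_pullback: "two_category A"
  by (rule two_category.intro)
    (simp_all add: u_simps u_Ob B.Hom_category B.Unit1_Ob B.Comp_functor B.Comp1_unit_left
      B.Comp1_unit_right B.Comp1_assoc B.Comp2_unit_left B.Comp2_unit_right B.Comp2_assoc)

end

context two_category
begin

text \<open>Functoriality of composition at a pair of identities. It collapses every whiskering of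
  an identity 2-cell, and such whiskerings are what the identity transformations below
  produce.\<close>

lemma Comp_hom_Ident:
  assumes "x \<in> Ob0 A" "y \<in> Ob0 A" "z \<in> Ob0 A" "f \<in> Ob (Hom A x y)" "g \<in> Ob (Hom A y z)"
  shows "Comp1 A x y z g f \<in> Ob (Hom A x z)"
    and "Comp2 A x y z (Ident (Hom A y z) g) (Ident (Hom A x y) f) = Ident (Hom A x z) (Comp1 A x y z g f)"
  using cat_functor.map_Ob[OF Comp_functor[OF assms(1-3)], of "(g, f)"]
    cat_functor.map_Ident[OF Comp_functor[OF assms(1-3)], of "(g, f)"] assms(4,5)
  by (simp_all add: prod_cat_def)

end

section \<open>Identity and composite 2-functors\<close>

lemma (in two_category) two_functor_id: "two_functor A A id_two_map"
  by (rule two_functor.intro) (simp_all add: id_two_map_def cat_functor_id Hom_category)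

lemma two_functor_comp:
  assumes "two_functor A B P" "two_functor B C Q"
  shows "two_functor A C (comp_two_map Q P)"
proof -
  interpret P: two_functor A B P by fact
  interpret Q: two_functor B C Q by fact
  show ?thesis
  proof (rule two_functor.intro)
    fix x y assume [simp]: "x \<in> Ob0 A" "y \<in> Ob0 A"
    interpret p: cat_functor "Hom A x y" "Hom B (Map0 P x) (Map0 P y)" "Map1 P x y" "Map2 P x y"
      by (simp add: P.Map_functor)
    interpret q: cat_functor "Hom B (Map0 P x) (Map0 P y)" "Hom C (Map0 Q (Map0 P x)) (Map0 Q (Map0 P y))"
      "Map1 Q (Map0 P x) (Map0 P y)" "Map2 Q (Map0 P x) (Map0 P y)"
      by (simp add: P.Map0_Ob Q.Map_functor)
    show "cat_functor (Hom A x y) (Hom C (Map0 (comp_two_map Q P) x) (Map0 (comp_two_map Q P) y))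
        (Map1 (comp_two_map Q P) x y) (Map2 (comp_two_map Q P) x y)"
      unfolding comp_two_map_def two_map.simps
      by unfold_locales (auto simp: p.map_Comp intro: p.map_hom q.map_hom q.map_Comp)
  next
    fix x y z f g assume [simp]: "x \<in> Ob0 A" "y \<in> Ob0 A" "z \<in> Ob0 A"
      "f \<in> Ob (Hom A x y)" "g \<in> Ob (Hom A y z)"
    have [simp]: "Map1 P x y f \<in> Ob (Hom B (Map0 P x) (Map0 P y))"
      "Map1 P y z g \<in> Ob (Hom B (Map0 P y) (Map0 P z))"
      by (simp_all add: cat_functor.map_Ob[OF P.Map_functor])
    show "Map1 (comp_two_map Q P) x z (Comp1 A x y z g f)
      = Comp1 C (Map0 (comp_two_map Q P) x) (Map0 (comp_two_map Q P) y) (Map0 (comp_two_map Q P) z)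
          (Map1 (comp_two_map Q P) y z g) (Map1 (comp_two_map Q P) x y f)"
      by (simp add: comp_two_map_def P.Map1_comp Q.Map1_comp P.Map0_Ob)
  next
    fix x y z \<alpha> \<beta> assume [simp]: "x \<in> Ob0 A" "y \<in> Ob0 A" "z \<in> Ob0 A"
      "\<alpha> \<in> Ar (Hom A x y)" "\<beta> \<in> Ar (Hom A y z)"
    have [simp]: "Map2 P x y \<alpha> \<in> Ar (Hom B (Map0 P x) (Map0 P y))"
      "Map2 P y z \<beta> \<in> Ar (Hom B (Map0 P y) (Map0 P z))"
      by (simp_all add: cat_functor.map_Ar[OF P.Map_functor])
    show "Map2 (comp_two_map Q P) x z (Comp2 A x y z \<beta> \<alpha>)
      = Comp2 C (Map0 (comp_two_map Q P) x) (Map0 (comp_two_map Q P) y) (Map0 (comp_two_map Q P) z)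
          (Map2 (comp_two_map Q P) y z \<beta>) (Map2 (comp_two_map Q P) x y \<alpha>)"
      by (simp add: comp_two_map_def P.Map2_comp Q.Map2_comp P.Map0_Ob)
  qed (simp_all add: comp_two_map_def P.Map0_Ob Q.Map0_Ob P.Map1_unit Q.Map1_unit)
qed

section \<open>Identity transformations between 2-functors that agree after forgetting\<close>

context two_cat_pullback
begin

text \<open>
  \<open>P x\<close> and \<open>Q x\<close> may be different objects, but the identity 1-cell of \<open>u (P x) = u (Q x)\<close>
  in \<open>B\<close> is a 1-cell between them in \<open>A\<close>.
\<close>

context
  fixes X :: "('c, 'g, 's) two_cat" and P Q :: "('c, 'g, 's, 'a, 'f, 't) two_map"
  assumes X: "two_category X" and P: "two_functor X A P" and Q: "two_functor X A Q"
    and eq0: "\<And>x. x \<in> Ob0 X \<Longrightarrow> u (Map0 Q x) = u (Map0 P x)"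
    and eq1: "\<And>x y f. x \<in> Ob0 X \<Longrightarrow> y \<in> Ob0 X \<Longrightarrow> f \<in> Ob (Hom X x y) \<Longrightarrow> Map1 Q x y f = Map1 P x y f"
    and eq2: "\<And>x y \<alpha>. x \<in> Ob0 X \<Longrightarrow> y \<in> Ob0 X \<Longrightarrow> \<alpha> \<in> Ar (Hom X x y) \<Longrightarrow> Map2 Q x y \<alpha> = Map2 P x y \<alpha>"
begin

interpretation X: two_category X by (fact X)
interpretation P: two_functor X A P by (fact P)
interpretation Q: two_functor X A Q by (fact Q)

lemma u_Map0: "x \<in> Ob0 X \<Longrightarrow> u (Map0 P x) \<in> Ob0 B"
  by (simp add: u_Ob P.Map0_Ob)

text \<open>Typing in terms of \<open>B\<close>, the form left after rewriting with
  \<open>u_simps\<close>. It suffices to treat \<open>P\<close>, because \<open>eq0\<close>,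
  \<open>eq1\<close> and \<open>eq2\<close> rewrite the values of \<open>Q\<close> into those of
  \<open>P\<close>.\<close>

lemma Map_simps:
  assumes [simp]: "x \<in> Ob0 X" "y \<in> Ob0 X"
  shows "f \<in> Ob (Hom X x y) \<Longrightarrow> Map1 P x y f \<in> Ob (Hom B (u (Map0 P x)) (u (Map0 P y)))"
    and "\<alpha> \<in> Ar (Hom X x y) \<Longrightarrow> Map2 P x y \<alpha> \<in> Ar (Hom B (u (Map0 P x)) (u (Map0 P y)))"
    and "\<alpha> \<in> Ar (Hom X x y) \<Longrightarrow>
      Dom (Hom B (u (Map0 P x)) (u (Map0 P y))) (Map2 P x y \<alpha>) = Map1 P x y (Dom (Hom X x y) \<alpha>)"
    and "\<alpha> \<in> Ar (Hom X x y) \<Longrightarrow>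
      Cod (Hom B (u (Map0 P x)) (u (Map0 P y))) (Map2 P x y \<alpha>) = Map1 P x y (Cod (Hom X x y) \<alpha>)"
proof -
  interpret cat_functor "Hom X x y" "Hom B (u (Map0 P x)) (u (Map0 P y))" "Map1 P x y" "Map2 P x y"
    using P.Map_functor[of x y] by (simp add: Hom_u)
  show "f \<in> Ob (Hom X x y) \<Longrightarrow> Map1 P x y f \<in> Ob (Hom B (u (Map0 P x)) (u (Map0 P y)))"
    and "\<alpha> \<in> Ar (Hom X x y) \<Longrightarrow> Map2 P x y \<alpha> \<in> Ar (Hom B (u (Map0 P x)) (u (Map0 P y)))"
    and "\<alpha> \<in> Ar (Hom X x y) \<Longrightarrow>
      Dom (Hom B (u (Map0 P x)) (u (Map0 P y))) (Map2 P x y \<alpha>) = Map1 P x y (Dom (Hom X x y) \<alpha>)"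
    and "\<alpha> \<in> Ar (Hom X x y) \<Longrightarrow>
      Cod (Hom B (u (Map0 P x)) (u (Map0 P y))) (Map2 P x y \<alpha>) = Map1 P x y (Cod (Hom X x y) \<alpha>)"
    by simp_all
qed

lemma Map1_P_comp:
  assumes "x \<in> Ob0 X" "y \<in> Ob0 X" "z \<in> Ob0 X" "f \<in> Ob (Hom X x y)" "g \<in> Ob (Hom X y z)"
  shows "Map1 P x z (Comp1 X x y z g f)
    = Comp1 B (u (Map0 P x)) (u (Map0 P y)) (u (Map0 P z)) (Map1 P y z g) (Map1 P x y f)"
  using P.Map1_comp[OF assms] by (simp add: Comp1_u)

lemmas identity_simps = u_Map0 Map_simps Map1_P_comp eq0 eq1 eq2 u_simps
  B.Hom_category B.Unit1_Ob B.Comp1_unit_left B.Comp1_unit_right B.Comp_hom_Ident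
  B.Comp2_unit_left B.Comp2_unit_right category.Ident_Ar category.Comp_Ident category.iso_Ident

text \<open>With all components identities, each axiom reduces to a unit law in \<open>B\<close>.
  The components are prescribed on carriers for an arbitrary \<sigma>, so that the composite of two
  identity transformations is covered as well.\<close>

lemma pseudonatural_transformation_identity:
  assumes [simp]: "\<And>x. x \<in> Ob0 X \<Longrightarrow> PT1 \<sigma> x = Unit1 A (Map0 P x)"
    "\<And>x y f. x \<in> Ob0 X \<Longrightarrow> y \<in> Ob0 X \<Longrightarrow> f \<in> Ob (Hom X x y)
      \<Longrightarrow> PT2 \<sigma> x y f = Ident (Hom A (Map0 P x) (Map0 P y)) (Map1 P x y f)"
  shows "pseudonatural_transformation X A P Q \<sigma>"
proof -
  note [simp] = identity_simps
  show ?thesis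
  proof (intro pseudonatural_transformation.intro pseudonatural_transformation_axioms.intro P Q)
    fix x assume "x \<in> Ob0 X"
    moreover from this have "Unit1 X x \<in> Ob (Hom X x x)"
      by (rule X.Unit1_Ob)
    \<comment> \<open>The component at a unit 1-cell is the identity of its image under
      \<open>P\<close>; \<open>Map1_unit\<close> recognises that image as a unit 1-cell.\<close>
    ultimately show "PT1 \<sigma> x \<in> Ob (Hom A (Map0 P x) (Map0 Q x))"
      "PT2 \<sigma> x x (Unit1 X x) = Ident (Hom A (Map0 P x) (Map0 Q x)) (PT1 \<sigma> x)"
      using P.Map1_unit[of x] by simp_all
  next
    fix x y f assume "x \<in> Ob0 X" "y \<in> Ob0 X" "f \<in> Ob (Hom X x y)"
    then show "PT2 \<sigma> x y f \<in> hom (Hom A (Map0 P x) (Map0 Q y))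
        (Comp1 A (Map0 P x) (Map0 Q x) (Map0 Q y) (Map1 Q x y f) (PT1 \<sigma> x))
        (Comp1 A (Map0 P x) (Map0 P y) (Map0 Q y) (PT1 \<sigma> y) (Map1 P x y f))"
      and "iso_arr (Hom A (Map0 P x) (Map0 Q y)) (PT2 \<sigma> x y f)"
      by (simp_all add: hom_def)
  next
    fix x y \<alpha> f f' assume [simp]: "x \<in> Ob0 X" "y \<in> Ob0 X" and \<alpha>: "\<alpha> \<in> hom (Hom X x y) f f'"
    note [simp] = homD[OF \<alpha>]
    have [simp]: "f \<in> Ob (Hom X x y)" "f' \<in> Ob (Hom X x y)"
      using category.Dom_Ob[OF X.Hom_category, of x y \<alpha>] category.Cod_Ob[OF X.Hom_category, of x y \<alpha>]
      by simp_all
    show "PT2 \<sigma> x y f' \<cdot>\<^bsub>Hom A (Map0 P x) (Map0 Q y)\<^esub>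
          whisker_right A (Map0 P x) (Map0 Q x) (Map0 Q y) (Map2 Q x y \<alpha>) (PT1 \<sigma> x)
        = whisker_left A (Map0 P x) (Map0 P y) (Map0 Q y) (PT1 \<sigma> y) (Map2 P x y \<alpha>)
            \<cdot>\<^bsub>Hom A (Map0 P x) (Map0 Q y)\<^esub> PT2 \<sigma> x y f"
      by simp
  next
    fix x y z f g
    assume [simp]: "x \<in> Ob0 X" "y \<in> Ob0 X" "z \<in> Ob0 X" "f \<in> Ob (Hom X x y)" "g \<in> Ob (Hom X y z)"
    show "PT2 \<sigma> x z (Comp1 X x y z g f)
        = whisker_right A (Map0 P x) (Map0 P y) (Map0 Q z) (PT2 \<sigma> y z g) (Map1 P x y f)
            \<cdot>\<^bsub>Hom A (Map0 P x) (Map0 Q z)\<^esub>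
          whisker_left A (Map0 P x) (Map0 Q y) (Map0 Q z) (Map1 Q y z g) (PT2 \<sigma> x y f)"
      by (simp add: X.Comp_hom_Ident)
  qed
qed

text \<open>A composite of unit 1-cells is a unit and whiskered identities are identities. Off the
  carriers the composite may differ from \<open>id_ptrans A P\<close>, so the two are compared by an
  invertible modification rather than by an equality.\<close>

lemma comp_ptrans_identity:
  assumes "x \<in> Ob0 X"
  shows "PT1 (comp_ptrans A P Q P (id_ptrans A Q) (id_ptrans A P)) x = Unit1 A (Map0 P x)"
    and "y \<in> Ob0 X \<Longrightarrow> f \<in> Ob (Hom X x y) \<Longrightarrow>
      PT2 (comp_ptrans A P Q P (id_ptrans A Q) (id_ptrans A P)) x y f
        = Ident (Hom A (Map0 P x) (Map0 P y)) (Map1 P x y f)"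
  using assms by (simp_all add: comp_ptrans_def id_ptrans_def identity_simps)

end

text \<open>Both transformations have identity components, so the identity 2-cells on unit 1-cells
  form a modification. The preceding results are taken with \<open>Q\<close> equal to
  \<open>P\<close>, where the agreement conditions hold by reflexivity.\<close>

lemma invertible_modification_identity:
  assumes X: "two_category X" and P: "two_functor X A P"
    and \<sigma>: "\<And>x. x \<in> Ob0 X \<Longrightarrow> PT1 \<sigma> x = Unit1 A (Map0 P x)"
      "\<And>x y f. x \<in> Ob0 X \<Longrightarrow> y \<in> Ob0 X \<Longrightarrow> f \<in> Ob (Hom X x y)
        \<Longrightarrow> PT2 \<sigma> x y f = Ident (Hom A (Map0 P x) (Map0 P y)) (Map1 P x y f)"
  shows "invertible_modification X A P P \<sigma> (id_ptrans A P) (\<lambda>x. Unit2 A (Map0 P x))"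
proof -
  note [simp] = \<sigma> u_simps
    B.Hom_category B.Unit1_Ob B.Comp1_unit_left B.Comp1_unit_right B.Comp_hom_Ident
    category.Ident_Ar category.Comp_Ident category.iso_Ident u_Map0[OF X P P refl refl refl] Map_simps[OF X P P refl refl refl]
  have id: "PT1 (id_ptrans A P) x = Unit1 A (Map0 P x)"
    "PT2 (id_ptrans A P) x y f = Ident (Hom A (Map0 P x) (Map0 P y)) (Map1 P x y f)" for x y f
    by (simp_all add: id_ptrans_def)
  show ?thesis
    unfolding invertible_modification_def
  proof (intro conjI ballI modification.intro modification_axioms.intro)
    show "pseudonatural_transformation X A P P \<sigma>"
      by (rule pseudonatural_transformation_identity[OF X P P refl refl refl]) (simp_all del: u_simps)
    show "pseudonatural_transformation X A P P (id_ptrans A P)"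
      by (rule pseudonatural_transformation_identity[OF X P P refl refl refl]) (simp_all add: id del: u_simps)
  qed (auto simp: id hom_def)
qed

text \<open>Hom-categories of \<open>A\<close> see objects through \<open>u\<close>, so
  \<open>id_ptrans A P\<close> also types as a transformation from \<open>P\<close> to
  \<open>Q\<close>. The agreement conditions are symmetric, and \<open>id_ptrans A Q\<close> is a
  quasi-inverse.\<close>

lemma pseudonatural_equivalence_identity:
  assumes X: "two_category X" and P: "two_functor X A P" and Q: "two_functor X A Q"
    and eq0: "\<And>x. x \<in> Ob0 X \<Longrightarrow> u (Map0 Q x) = u (Map0 P x)"
    and eq1: "\<And>x y f. x \<in> Ob0 X \<Longrightarrow> y \<in> Ob0 X \<Longrightarrow> f \<in> Ob (Hom X x y) \<Longrightarrow> Map1 Q x y f = Map1 P x y f"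
    and eq2: "\<And>x y \<alpha>. x \<in> Ob0 X \<Longrightarrow> y \<in> Ob0 X \<Longrightarrow> \<alpha> \<in> Ar (Hom X x y) \<Longrightarrow> Map2 Q x y \<alpha> = Map2 P x y \<alpha>"
  shows "pseudonatural_equivalence X A P Q (id_ptrans A P)"
proof -
  note PQ = X P Q eq0 eq1 eq2
  note QP = X Q P eq0[symmetric] eq1[symmetric] eq2[symmetric]
  show ?thesis
    unfolding pseudonatural_equivalence_def
  proof (intro conjI exI)
    show "pseudonatural_transformation X A P Q (id_ptrans A P)"
      by (rule pseudonatural_transformation_identity[OF PQ]) (simp_all add: id_ptrans_def)
    show "pseudonatural_transformation X A Q P (id_ptrans A Q)"
      by (rule pseudonatural_transformation_identity[OF QP]) (simp_all add: id_ptrans_def)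
    show "invertible_modification X A P P (comp_ptrans A P Q P (id_ptrans A Q) (id_ptrans A P))
        (id_ptrans A P) (\<lambda>x. Unit2 A (Map0 P x))"
      by (rule invertible_modification_identity[OF X P]) (simp_all add: comp_ptrans_identity[OF PQ])
    show "invertible_modification X A Q Q (comp_ptrans A Q P Q (id_ptrans A P) (id_ptrans A Q))
        (id_ptrans A Q) (\<lambda>x. Unit2 A (Map0 Q x))"
      by (rule invertible_modification_identity[OF X Q]) (simp_all add: comp_ptrans_identity[OF QP])
  qed
qed

end

section \<open>Weak and coherent 2-groups\<close>

lemma truncate_simps [simp]:
  "Ob (moncat.truncate C) = Ob C" "Ar (moncat.truncate C) = Ar C"
  "Dom (moncat.truncate C) = Dom C" "Cod (moncat.truncate C) = Cod C"
  "Ident (moncat.truncate C) = Ident C" "Comp (moncat.truncate C) = Comp C"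
  "TensOb (moncat.truncate C) = TensOb C" "TensAr (moncat.truncate C) = TensAr C"
  "UnitOb (moncat.truncate C) = UnitOb C" "Assoc (moncat.truncate C) = Assoc C"
  "LUnit (moncat.truncate C) = LUnit C" "RUnit (moncat.truncate C) = RUnit C"
  "hom (moncat.truncate C) = hom C"
  "iso_arr (moncat.truncate C) = iso_arr C"
  "isomorphic (moncat.truncate C) = isomorphic C"
  "weak_inverse (moncat.truncate C) = weak_inverse C"
  by (simp_all add: moncat.truncate_def fun_eq_iff hom_def iso_arr_def inverse_arrows_def
      isomorphic_def weak_inverse_def)

lemma category_truncate: "category (moncat.truncate C) \<longleftrightarrow> category C"
  by (simp add: category_def)

lemma weak_monoidal_category_truncate:
  "weak_monoidal_category (moncat.truncate C) \<longleftrightarrow> weak_monoidal_category C"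
proof -
  \<comment> \<open>The tensor axiom mentions the product category. \<open>prod_cat\<close> builds a
    plain \<open>cat\<close> record from fields that truncation keeps, so the two products are
    equal.\<close>
  have "prod_cat (moncat.truncate C) (moncat.truncate C) = prod_cat C C"
    by (simp add: prod_cat_def)
  then show ?thesis
    by (simp add: weak_monoidal_category_def weak_monoidal_category_axioms_def category_truncate
        cat_functor_def cat_functor_axioms_def)
qed

text \<open>The chosen dual is a weak inverse: the counit gives one of the required isomorphisms,
  and the inverse of the unit of the adjunction gives the other.\<close>

lemma weak_2_group_underlying:
  assumes "coherent_2_group C"
  shows "weak_2_group (underlying C)"
proof -
  interpret coherent_2_group C by fact
  have "\<exists>y. weak_inverse C x y" if x: "x \<in> Ob C" for x
  proof -
    interpret adjoint_equivalence C x "Dual C x" "AdjUnit C x" "AdjCounit C x"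
      using x by (rule adj_equiv)
    have "isomorphic C (UnitOb C) (x \<odot>\<^bsub>C\<^esub> Dual C x)" "isomorphic C (Dual C x \<odot>\<^bsub>C\<^esub> x) (UnitOb C)"
      using i_hom i_iso e_hom e_iso by (auto simp: isomorphic_def)
    then have "weak_inverse C x (Dual C x)"
      by (simp add: weak_inverse_def x'_Ob isomorphic_sym)
    then show ?thesis ..
  qed
  then show ?thesis
    using weak_monoidal_category_axioms all_iso
    by (simp add: weak_2_group_def weak_2_group_axioms_def weak_monoidal_category_truncate)
qed

lemma two_cat_pullback_C2G: "two_cat_pullback C2G W2G underlying"
  by (intro two_cat_pullback.intro two_cat_pullback_axioms.intro two_category_W2G)
    (simp_all add: C2G_def W2G_def weak_2_group_underlying)

text \<open>\<open>C2G\<close> takes its hom-categories and compositions from the underlying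
  monoidal categories, so on cells every preservation law is trivial; the content is that objects
  land in \<open>W2G\<close>.\<close>

lemma two_functor_forget: "two_functor C2G W2G forget_C2G"
  by (rule two_functor.intro)
    (simp_all add: C2G_def W2G_def forget_C2G_def weak_2_group_underlying cat_functor_id category_monfun_cat)

theorem theorem16:
  fixes imp :: "(('o, 'm) moncat, ('o, 'm, 'o, 'm) monfun, ('o, 'm, 'o, 'm) montrans,
    ('o, 'm) coh_moncat, ('o, 'm, 'o, 'm) monfun, ('o, 'm, 'o, 'm) montrans) two_map"
  assumes "two_functor W2G C2G imp"
    and "\<And>C. C \<in> Ob0 W2G \<Longrightarrow> underlying (Map0 imp C) = C"
    and "\<And>C D F. C \<in> Ob0 W2G \<Longrightarrow> D \<in> Ob0 W2G \<Longrightarrow> F \<in> Ob (Hom W2G C D)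
      \<Longrightarrow> Map1 imp C D F = F"
    and "\<And>C D \<theta>. C \<in> Ob0 W2G \<Longrightarrow> D \<in> Ob0 W2G \<Longrightarrow> \<theta> \<in> Ar (Hom W2G C D)
      \<Longrightarrow> Map2 imp C D \<theta> = \<theta>"
  shows "biequivalence W2G C2G imp forget_C2G"
proof -
  \<comment> \<open>Here nothing is forgotten. The general statement is still the right one, because
    the composite is known to agree with the identity 2-functor on carriers only.\<close>
  interpret W: two_cat_pullback "W2G :: (('o, 'm) moncat, _, _) two_cat" W2G "\<lambda>C. C"
    by (intro two_cat_pullback.intro two_cat_pullback_axioms.intro two_category_W2G) simp_all
  interpret C: two_cat_pullback "C2G :: (('o, 'm) coh_moncat, _, _) two_cat" W2G underlying
    by (rule two_cat_pullback_C2G)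
  note two_cats = two_category_W2G C.two_category_pullback
  note ids = two_cats[THEN two_category.two_functor_id]
  show ?thesis
    unfolding biequivalence_def
  proof (intro conjI exI two_cats assms(1) two_functor_forget)
    show "pseudonatural_equivalence W2G W2G (comp_two_map forget_C2G imp) id_two_map
        (id_ptrans W2G (comp_two_map forget_C2G imp))"
      by (rule W.pseudonatural_equivalence_identity[OF two_cats(1)
            two_functor_comp[OF assms(1) two_functor_forget] ids(1)])
        (simp_all add: comp_two_map_def id_two_map_def forget_C2G_def assms(2-4))
    show "pseudonatural_equivalence C2G C2G (comp_two_map imp forget_C2G) id_two_map
        (id_ptrans C2G (comp_two_map imp forget_C2G))"
      \<comment> \<open>The hypotheses on \<open>imp\<close> concern \<open>W2G\<close>.
        \<open>C.u_Ob\<close> places the underlying category of a coherent 2-group there, and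
        \<open>C.Hom_u\<close> turns cells of \<open>C2G\<close> into cells of \<open>W2G\<close>,
        so that they become applicable.\<close>
      by (rule C.pseudonatural_equivalence_identity[OF two_cats(2)
            two_functor_comp[OF two_functor_forget assms(1)] ids(2)])
        (simp_all add: comp_two_map_def id_two_map_def forget_C2G_def assms(2-4) C.u_Ob C.Hom_u)
  qed
qed

end
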